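(* The monoidal category $(\mathrm{EQA},\boxtimes,\mathfrak{K})$ is rigid, and has $\dagger$ as duality functor. For every $\mathfrak{V}=(\mathbf{V},R)$ in $\mathrm{EQA}$, the evaluation and coevaluation arrows, $ev_{\mathfrak{V}}:\mathfrak{V}^{\dagger}\boxtimes\mathfrak{V}\to\mathfrak{K}$ and $coev_{\mathfrak{V}}:\mathfrak{K}\to\mathfrak{V}\boxtimes\mathfrak{V}^{\dagger}$, respectively, are given by the corresponding maps $\mathbf{V}^{*}\otimes\mathbf{V}\to\Bbbk$ and $\Bbbk\to\mathbf{V}\otimes\mathbf{V}^{*}$ for $\mathbf{V}$ in the rigid monoidal category $(\mathrm{Vct}_f,\otimes,\Bbbk)$ of finite dimensional $\Bbbk$-vector spaces.
   Context: $\Bbbk$ is $\mathbb{R}$ or $\mathbb{C}$. The category $\mathrm{EQA}$ of equipped quantum spaces is described (up to equivalence) as follows: objects are pairs $\mathfrak{V}=(\mathbf{V},R)$ with $\mathbf{V}$ a finite dimensional $\Bbbk$-vector space and $R:\mathbf{V}^{\otimes 2}\to\mathbf{V}^{\otimes 2}$ linear; arrows $(\mathbf{V},R)\to(\mathbf{W},S)$ are linear maps $l:\mathbf{V}\to\mathbf{W}$ with $l^{\otimes 2}R=S\,l^{\otimes 2}$. Monoidal structure: $(\mathbf{V},R)\boxtimes(\mathbf{W},S)=(\mathbf{V}\otimes\mathbf{W},R\boxtimes S)$, where $R\boxtimes S=\varphi_{\mathbf{V},\mathbf{W}}^{-1}(R\otimes\mathrm{id}+\mathrm{id}\otimes S)\varphi_{\mathbf{V},\mathbf{W}}$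 and $\varphi_{\mathbf{V},\mathbf{W}}:(\mathbf{V}\otimes\mathbf{W})^{\otimes 2}\to\mathbf{V}^{\otimes 2}\otimes\mathbf{W}^{\otimes 2}$ is $v\otimes w\otimes v'\otimes w'\mapsto v\otimes v'\otimes w\otimes w'$; on arrows $k\boxtimes l=k\otimes l$. The unit object is $\mathfrak{K}=(\Bbbk,0)$, with $0$ the null endomorphism of $\Bbbk^{\otimes 2}$. The associativity, unit and symmetry isomorphisms are the usual ones of vector spaces. The contravariant functor $\dagger:\mathrm{EQA}\to\mathrm{EQA}$ is $\mathfrak{V}=(\mathbf{V},R)\mapsto\mathfrak{V}^{\dagger}=(\mathbf{V}^{*},-R^{*})$ and $l\mapsto l^{\dagger}=l^{*}$, where $R^{*}:(\mathbf{V}^* )^{\otimes 2}\to(\mathbf{V}^* )^{\otimes 2}$ is the transpose of $R$ with respect to the usual extension (factor by factor) to $\mathbf{V}^{\otimes 2}$ of the pairing between $\mathbf{V}$ and $\mathbf{V}^{*}$, and $l^*$ is the transpose of $l$. "Rigid with duality functor $\dagger$" means: every object $\mathfrak{V}$ has $\mathfrak{V}^{\dagger}$ as a dual, with evaluation and coevaluation arrows satisfying the triangle (zig-zag) identities, and the dual of an arrow $l$ induced by these is $l^{\dagger}$. *)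

theory Defs
  imports Complex_Main "HOL-Library.Poly_Mapping" "HOL-Algebra.AbelCoset" "Jordan_Normal_Form.VS_Connect"
begin

text \<open>The ground field is the real or the complex field: a field extension of the reals of
  degree at most two.\<close>

class real_or_complex = real_field +
  assumes degree_le_2: "\<exists>i. \<forall>x. \<exists>a b. x = scaleR a 1 + scaleR b i"

instance real :: real_or_complex
  by standard (auto intro: exI[of _ 0])

instance complex :: real_or_complex
  by standard (metis complex_eq mult.commute mult.right_neutral scaleR_conv_of_real)


section \<open>Vector spaces, tensor products and duals\<close>

text \<open>A vector space is a carrier-based record of type \<open>('k, 'v) module\<close> satisfying
  \<open>vectorspace class_ring\<close>. Maps between vector spaces matter only on the carriers; outside they
  are arbitrary, so all equations between maps below are required on carriers only.\<close>

definition fd_vs :: "('k::field, 'v) module \<Rightarrow> bool" where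
  "fd_vs V \<longleftrightarrow> vectorspace class_ring V \<and> vectorspace.fin_dim class_ring V"

abbreviation linear_on :: "('k::field, 'v) module \<Rightarrow> ('k, 'w) module \<Rightarrow> ('v \<Rightarrow> 'w) \<Rightarrow> bool" where
  "linear_on V W f \<equiv> linear_map class_ring V W f"

definition bilinear_on ::
  "('k::field, 'v) module \<Rightarrow> ('k, 'w) module \<Rightarrow> ('k, 'u) module \<Rightarrow> ('v \<Rightarrow> 'w \<Rightarrow> 'u) \<Rightarrow> bool" where
  "bilinear_on V W U \<beta> \<longleftrightarrow>
     (\<forall>v\<in>carrier V. linear_on W U (\<beta> v)) \<and> (\<forall>w\<in>carrier W. linear_on V U (\<lambda>v. \<beta> v w))"

definition ground :: "('k::field, 'k) module" where
  "ground = \<lparr>carrier = UNIV, mult = (*), one = 1, zero = 0, add = (+), smult = (*)\<rparr>"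

definition free_vs :: "'a set \<Rightarrow> ('k::field, 'a \<Rightarrow>\<^sub>0 'k) module" where
  "free_vs X = \<lparr>carrier = {p. Poly_Mapping.keys p \<subseteq> X}, mult = undefined, one = undefined,
     zero = 0, add = (+), smult = (\<lambda>c. Poly_Mapping.map ((*) c))\<rparr>"

text \<open>In the scalar multiplication on cosets, adding \<open>N\<close> is needed only for the scalar \<open>0\<close>.\<close>

definition quotient_vs :: "('k::field, 'a) module \<Rightarrow> 'a set \<Rightarrow> ('k, 'a set) module" where
  "quotient_vs M N = \<lparr>carrier = a_rcosets\<^bsub>M\<^esub> N, mult = undefined, one = undefined, zero = N,
     add = (\<lambda>A B. A <+>\<^bsub>M\<^esub> B), smult = (\<lambda>c A. N <+>\<^bsub>M\<^esub> (\<lambda>x. c \<odot>\<^bsub>M\<^esub> x) ` A)\<rparr>"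

definition tensor_relators ::
  "('k::field, 'v) module \<Rightarrow> ('k, 'w) module \<Rightarrow> ('v \<times> 'w \<Rightarrow>\<^sub>0 'k) set" where
  "tensor_relators V W =
     (let e = (\<lambda>v w. Poly_Mapping.single (v, w) 1);
          sc = (\<lambda>c. Poly_Mapping.map ((*) c))
      in {e (v \<oplus>\<^bsub>V\<^esub> v') w - e v w - e v' w |v v' w. v \<in> carrier V \<and> v' \<in> carrier V \<and> w \<in> carrier W}
       \<union> {e v (w \<oplus>\<^bsub>W\<^esub> w') - e v w - e v w' |v w w'. v \<in> carrier V \<and> w \<in> carrier W \<and> w' \<in> carrier W}
       \<union> {e (c \<odot>\<^bsub>V\<^esub> v) w - sc c (e v w) |c v w. v \<in> carrier V \<and> w \<in> carrier W}
       \<union> {e v (c \<odot>\<^bsub>W\<^esub> w) - sc c (e v w) |c v w. v \<in> carrier V \<and> w \<in> carrier W})"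

definition tensor_null ::
  "('k::field, 'v) module \<Rightarrow> ('k, 'w) module \<Rightarrow> ('v \<times> 'w \<Rightarrow>\<^sub>0 'k) set" where
  "tensor_null V W =
     LinearCombinations.module.span class_ring (free_vs (carrier V \<times> carrier W)) (tensor_relators V W)"

definition tensor ::
  "('k::field, 'v) module \<Rightarrow> ('k, 'w) module \<Rightarrow> ('k, ('v \<times> 'w \<Rightarrow>\<^sub>0 'k) set) module" where
  "tensor V W = quotient_vs (free_vs (carrier V \<times> carrier W)) (tensor_null V W)"

definition ptensor ::
  "('k::field, 'v) module \<Rightarrow> ('k, 'w) module \<Rightarrow> 'v \<Rightarrow> 'w \<Rightarrow> ('v \<times> 'w \<Rightarrow>\<^sub>0 'k) set" where
  "ptensor V W v w =
     tensor_null V W +>\<^bsub>free_vs (carrier V \<times> carrier W)\<^esub> Poly_Mapping.single (v, w) 1"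

text \<open>Linear maps out of tensor products are specified by their values on pure tensors; since these
  span, \<open>SOME\<close> below picks a map which is uniquely determined on the carrier.\<close>

definition tensor_lift ::
  "('k::field, 'v) module \<Rightarrow> ('k, 'w) module \<Rightarrow> ('k, 'u) module \<Rightarrow> ('v \<Rightarrow> 'w \<Rightarrow> 'u)
     \<Rightarrow> ('v \<times> 'w \<Rightarrow>\<^sub>0 'k) set \<Rightarrow> 'u" where
  "tensor_lift V W U \<beta> = (SOME f. linear_on (tensor V W) U f \<and>
     (\<forall>v\<in>carrier V. \<forall>w\<in>carrier W. f (ptensor V W v w) = \<beta> v w))"

definition tensor_map ::
  "('k::field, 'v) module \<Rightarrow> ('k, 'w) module \<Rightarrow> ('k, 'v2) module \<Rightarrow> ('k, 'w2) module
     \<Rightarrow> ('v \<Rightarrow> 'v2) \<Rightarrow> ('w \<Rightarrow> 'w2) \<Rightarrow> ('v \<times> 'w \<Rightarrow>\<^sub>0 'k) set \<Rightarrow> ('v2 \<times> 'w2 \<Rightarrow>\<^sub>0 'k) set" where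
  "tensor_map V W V' W' k l = tensor_lift V W (tensor V' W') (\<lambda>v w. ptensor V' W' (k v) (l w))"

definition assoc ::
  "('k::field, 'v) module \<Rightarrow> ('k, 'w) module \<Rightarrow> ('k, 'u) module
     \<Rightarrow> (('v \<times> 'w \<Rightarrow>\<^sub>0 'k) set \<times> 'u \<Rightarrow>\<^sub>0 'k) set \<Rightarrow> ('v \<times> ('w \<times> 'u \<Rightarrow>\<^sub>0 'k) set \<Rightarrow>\<^sub>0 'k) set" where
  "assoc V W U = (SOME f. linear_on (tensor (tensor V W) U) (tensor V (tensor W U)) f \<and>
     (\<forall>v\<in>carrier V. \<forall>w\<in>carrier W. \<forall>u\<in>carrier U.
        f (ptensor (tensor V W) U (ptensor V W v w) u)
          = ptensor V (tensor W U) v (ptensor W U w u)))"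

definition lunit :: "('k::field, 'v) module \<Rightarrow> ('k \<times> 'v \<Rightarrow>\<^sub>0 'k) set \<Rightarrow> 'v" where
  "lunit V = tensor_lift ground V V (\<lambda>c v. c \<odot>\<^bsub>V\<^esub> v)"

definition runit :: "('k::field, 'v) module \<Rightarrow> ('v \<times> 'k \<Rightarrow>\<^sub>0 'k) set \<Rightarrow> 'v" where
  "runit V = tensor_lift V ground V (\<lambda>v c. c \<odot>\<^bsub>V\<^esub> v)"

abbreviation assoc_inv ::
  "('k::field, 'v) module \<Rightarrow> ('k, 'w) module \<Rightarrow> ('k, 'u) module
     \<Rightarrow> ('v \<times> ('w \<times> 'u \<Rightarrow>\<^sub>0 'k) set \<Rightarrow>\<^sub>0 'k) set \<Rightarrow> (('v \<times> 'w \<Rightarrow>\<^sub>0 'k) set \<times> 'u \<Rightarrow>\<^sub>0 'k) set" where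
  "assoc_inv V W U \<equiv> inv_into (carrier (tensor (tensor V W) U)) (assoc V W U)"

abbreviation lunit_inv :: "('k::field, 'v) module \<Rightarrow> 'v \<Rightarrow> ('k \<times> 'v \<Rightarrow>\<^sub>0 'k) set" where
  "lunit_inv V \<equiv> inv_into (carrier (tensor ground V)) (lunit V)"

abbreviation runit_inv :: "('k::field, 'v) module \<Rightarrow> 'v \<Rightarrow> ('v \<times> 'k \<Rightarrow>\<^sub>0 'k) set" where
  "runit_inv V \<equiv> inv_into (carrier (tensor V ground)) (runit V)"

definition middle_swap ::
  "('k::field, 'v) module \<Rightarrow> ('k, 'w) module
     \<Rightarrow> (('v \<times> 'w \<Rightarrow>\<^sub>0 'k) set \<times> ('v \<times> 'w \<Rightarrow>\<^sub>0 'k) set \<Rightarrow>\<^sub>0 'k) set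
     \<Rightarrow> (('v \<times> 'v \<Rightarrow>\<^sub>0 'k) set \<times> ('w \<times> 'w \<Rightarrow>\<^sub>0 'k) set \<Rightarrow>\<^sub>0 'k) set" where
  "middle_swap V W = (SOME f.
     linear_on (tensor (tensor V W) (tensor V W)) (tensor (tensor V V) (tensor W W)) f \<and>
     (\<forall>v\<in>carrier V. \<forall>w\<in>carrier W. \<forall>v'\<in>carrier V. \<forall>w'\<in>carrier W.
        f (ptensor (tensor V W) (tensor V W) (ptensor V W v w) (ptensor V W v' w'))
          = ptensor (tensor V V) (tensor W W) (ptensor V V v v') (ptensor W W w w')))"

definition dual :: "('k::field, 'v) module \<Rightarrow> ('k, 'v \<Rightarrow> 'k) module" where
  "dual V = \<lparr>carrier = {f \<in> extensional (carrier V). linear_on V ground f},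
     mult = undefined, one = undefined, zero = (\<lambda>v\<in>carrier V. 0),
     add = (\<lambda>f g. \<lambda>v\<in>carrier V. f v + g v), smult = (\<lambda>c f. \<lambda>v\<in>carrier V. c * f v)\<rparr>"

definition transpose_map :: "('k::field, 'v) module \<Rightarrow> ('v \<Rightarrow> 'w) \<Rightarrow> ('w \<Rightarrow> 'k) \<Rightarrow> ('v \<Rightarrow> 'k)" where
  "transpose_map V l = (\<lambda>g. \<lambda>v\<in>carrier V. g (l v))"

definition pairing2 ::
  "('k::field, 'v) module \<Rightarrow> (('v \<Rightarrow> 'k) \<times> ('v \<Rightarrow> 'k) \<Rightarrow>\<^sub>0 'k) set \<Rightarrow> ('v \<times> 'v \<Rightarrow>\<^sub>0 'k) set \<Rightarrow> 'k" where
  "pairing2 V = (SOME B. bilinear_on (tensor (dual V) (dual V)) (tensor V V) ground B \<and>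
     (\<forall>f\<in>carrier (dual V). \<forall>g\<in>carrier (dual V). \<forall>v\<in>carrier V. \<forall>w\<in>carrier V.
        B (ptensor (dual V) (dual V) f g) (ptensor V V v w) = f v * g w))"

definition transpose2 ::
  "('k::field, 'v) module \<Rightarrow> (('v \<times> 'v \<Rightarrow>\<^sub>0 'k) set \<Rightarrow> ('v \<times> 'v \<Rightarrow>\<^sub>0 'k) set)
     \<Rightarrow> (('v \<Rightarrow> 'k) \<times> ('v \<Rightarrow> 'k) \<Rightarrow>\<^sub>0 'k) set \<Rightarrow> (('v \<Rightarrow> 'k) \<times> ('v \<Rightarrow> 'k) \<Rightarrow>\<^sub>0 'k) set" where
  "transpose2 V R = (SOME Q.
     linear_on (tensor (dual V) (dual V)) (tensor (dual V) (dual V)) Q \<and>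
     (\<forall>\<xi>\<in>carrier (tensor (dual V) (dual V)). \<forall>t\<in>carrier (tensor V V).
        pairing2 V (Q \<xi>) t = pairing2 V \<xi> (R t)))"

definition ev :: "('k::field, 'v) module \<Rightarrow> (('v \<Rightarrow> 'k) \<times> 'v \<Rightarrow>\<^sub>0 'k) set \<Rightarrow> 'k" where
  "ev V = tensor_lift (dual V) V ground (\<lambda>f v. f v)"

definition dual_vector :: "('k::field, 'v) module \<Rightarrow> 'v set \<Rightarrow> 'v \<Rightarrow> ('v \<Rightarrow> 'k)" where
  "dual_vector V B b =
     (THE f. f \<in> carrier (dual V) \<and> (\<forall>b'\<in>B. f b' = (if b' = b then 1 else 0)))"

text \<open>The canonical element \<open>\<Sum>\<^sub>b b \<otimes> b\<^sup>*\<close> does not depend on the chosen basis.\<close>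

definition coev :: "('k::field, 'v) module \<Rightarrow> 'k \<Rightarrow> ('v \<times> ('v \<Rightarrow> 'k) \<Rightarrow>\<^sub>0 'k) set" where
  "coev V = (let B = (SOME B. finite B \<and> vectorspace.basis class_ring V B) in
     (\<lambda>c. c \<odot>\<^bsub>tensor V (dual V)\<^esub>
        (\<Oplus>\<^bsub>tensor V (dual V)\<^esub> b\<in>B. ptensor V (dual V) b (dual_vector V B b))))"


section \<open>The category EQA\<close>

type_synonym ('k, 'v) eqa =
  "('k, 'v) module \<times> (('v \<times> 'v \<Rightarrow>\<^sub>0 'k) set \<Rightarrow> ('v \<times> 'v \<Rightarrow>\<^sub>0 'k) set)"

fun eqa_obj :: "('k::field, 'v) eqa \<Rightarrow> bool" where
  "eqa_obj (V, R) \<longleftrightarrow> fd_vs V \<and> linear_on (tensor V V) (tensor V V) R"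

fun eqa_arrow :: "('k::field, 'v) eqa \<Rightarrow> ('k, 'w) eqa \<Rightarrow> ('v \<Rightarrow> 'w) \<Rightarrow> bool" where
  "eqa_arrow (V, R) (W, S) l \<longleftrightarrow> eqa_obj (V, R) \<and> eqa_obj (W, S) \<and> linear_on V W l \<and>
     (\<forall>t\<in>carrier (tensor V V). tensor_map V V W W l l (R t) = S (tensor_map V V W W l l t))"

fun eqa_tensor :: "('k::field, 'v) eqa \<Rightarrow> ('k, 'w) eqa \<Rightarrow> ('k, ('v \<times> 'w \<Rightarrow>\<^sub>0 'k) set) eqa" where
  "eqa_tensor (V, R) (W, S) =
     (tensor V W,
      \<lambda>t. inv_into (carrier (tensor (tensor V W) (tensor V W))) (middle_swap V W)
        (tensor_map (tensor V V) (tensor W W) (tensor V V) (tensor W W) R (\<lambda>y. y) (middle_swap V W t)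
         \<oplus>\<^bsub>tensor (tensor V V) (tensor W W)\<^esub>
         tensor_map (tensor V V) (tensor W W) (tensor V V) (tensor W W) (\<lambda>x. x) S (middle_swap V W t)))"

definition eqa_unit :: "('k::field, 'k) eqa" where
  "eqa_unit = (ground, \<lambda>t. \<zero>\<^bsub>tensor ground ground\<^esub>)"

fun eqa_dagger :: "('k::field, 'v) eqa \<Rightarrow> ('k, 'v \<Rightarrow> 'k) eqa" where
  "eqa_dagger (V, R) = (dual V, \<lambda>\<xi>. \<ominus>\<^bsub>tensor (dual V) (dual V)\<^esub> transpose2 V R \<xi>)"

text \<open>The two triangle identities, for \<open>e : D \<otimes> V \<rightarrow> k\<close> and \<open>c : k \<rightarrow> V \<otimes> D\<close>.\<close>

definition zigzag ::
  "('k::field, 'v) module \<Rightarrow> ('k, 'd) module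
     \<Rightarrow> (('d \<times> 'v \<Rightarrow>\<^sub>0 'k) set \<Rightarrow> 'k) \<Rightarrow> ('k \<Rightarrow> ('v \<times> 'd \<Rightarrow>\<^sub>0 'k) set) \<Rightarrow> bool" where
  "zigzag V D e c \<longleftrightarrow>
     (\<forall>v\<in>carrier V.
        (runit V \<circ> tensor_map V (tensor D V) V ground (\<lambda>x. x) e \<circ> assoc V D V
          \<circ> tensor_map ground V (tensor V D) V c (\<lambda>x. x) \<circ> lunit_inv V) v = v) \<and>
     (\<forall>d\<in>carrier D.
        (lunit D \<circ> tensor_map (tensor D V) D ground D e (\<lambda>x. x) \<circ> assoc_inv D V D
          \<circ> tensor_map D ground D (tensor V D) (\<lambda>x. x) c \<circ> runit_inv D) d = d)"

text \<open>\<open>Y\<close> is a dual of \<open>X\<close> with evaluation \<open>e : Y \<boxtimes> X \<rightarrow> K\<close> and coevaluation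
  \<open>c : K \<rightarrow> X \<boxtimes> Y\<close>.\<close>

definition eqa_is_dual ::
  "('k::field, 'v) eqa \<Rightarrow> ('k, 'd) eqa
     \<Rightarrow> (('d \<times> 'v \<Rightarrow>\<^sub>0 'k) set \<Rightarrow> 'k) \<Rightarrow> ('k \<Rightarrow> ('v \<times> 'd \<Rightarrow>\<^sub>0 'k) set) \<Rightarrow> bool" where
  "eqa_is_dual X Y e c \<longleftrightarrow> eqa_obj X \<and> eqa_obj Y \<and>
     eqa_arrow (eqa_tensor Y X) eqa_unit e \<and> eqa_arrow eqa_unit (eqa_tensor X Y) c \<and>
     zigzag (fst X) (fst Y) e c"

text \<open>The dual \<open>E \<rightarrow> D\<close> of an arrow \<open>l : V \<rightarrow> W\<close>, where \<open>D\<close> is a dual of \<open>V\<close> with coevaluation \<open>c\<close>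
  and \<open>E\<close> is a dual of \<open>W\<close> with evaluation \<open>e\<close>.\<close>

definition dual_arrow ::
  "('k::field, 'v) module \<Rightarrow> ('k, 'd) module \<Rightarrow> ('k \<Rightarrow> ('v \<times> 'd \<Rightarrow>\<^sub>0 'k) set)
     \<Rightarrow> ('k, 'w) module \<Rightarrow> ('k, 'e) module \<Rightarrow> (('e \<times> 'w \<Rightarrow>\<^sub>0 'k) set \<Rightarrow> 'k)
     \<Rightarrow> ('v \<Rightarrow> 'w) \<Rightarrow> 'e \<Rightarrow> 'd" where
  "dual_arrow V D c W E e l =
     lunit D \<circ> tensor_map (tensor E W) D ground D e (\<lambda>x. x)
       \<circ> tensor_map (tensor E V) D (tensor E W) D (tensor_map E V E W (\<lambda>x. x) l) (\<lambda>x. x)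
       \<circ> assoc_inv E V D \<circ> tensor_map E ground E (tensor V D) (\<lambda>x. x) c \<circ> runit_inv E"

end

theory Submission
  imports Defs
begin

text \<open>
  A finite-dimensional space \<open>V\<close> with basis \<open>B\<close> has dual \<open>V\<^sup>*\<close>, evaluation \<open>f \<otimes> v \<mapsto> f v\<close> and
  coevaluation \<open>1 \<mapsto> \<Omega> = \<Sum>\<^sub>b b \<otimes> b\<^sup>*\<close>. The zig-zag identities say \<open>v = \<Sum>\<^sub>b b\<^sup>*(v) b\<close> and
  \<open>f = \<Sum>\<^sub>b f(b) b\<^sup>*\<close>, and the dual of an arrow \<open>l\<close> sends \<open>g\<close> to \<open>\<Sum>\<^sub>b g(l b) b\<^sup>* = g \<circ> l\<close>. This part
  is the linear algebra of \<open>V\<close>; it rests on \<open>basis_expand\<close> and \<open>dual_expand\<close>.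

  What has to be seen is that evaluation and coevaluation are arrows for the operators
  \<open>R\<^sup>\<dagger> \<boxtimes> R\<close>, \<open>R \<boxtimes> R\<^sup>\<dagger>\<close>, where \<open>R\<^sup>\<dagger> = - R\<^sup>*\<close>. After exchanging the two middle factors, \<open>R \<boxtimes> S\<close> is the
  Leibniz operator \<open>R \<otimes> id + id \<otimes> S\<close>, and \<open>ev \<otimes> ev\<close> becomes the pairing of
  \<open>(V\<^sup>*)\<^sup>\<otimes>\<^sup>2\<close> with \<open>V\<^sup>\<otimes>\<^sup>2\<close>, so that \<open>ev\<close> is an arrow to \<open>(k, 0)\<close> because
  \<open>- \<langle>R\<^sup>* \<xi>, t\<rangle> + \<langle>\<xi>, R t\<rangle> = 0\<close>. Dually, \<open>\<Omega> \<otimes> \<Omega>\<close> becomes the canonical element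
  \<open>\<Sum>\<^sub>p e\<^sub>p \<otimes> e\<^sub>p\<^sup>*\<close> of \<open>V\<^sup>\<otimes>\<^sup>2 \<otimes> (V\<^sup>*)\<^sup>\<otimes>\<^sup>2\<close>, and \<open>coev\<close> is an arrow because
  \<open>\<Sum>\<^sub>p R e\<^sub>p \<otimes> e\<^sub>p\<^sup>* = \<Sum>\<^sub>p e\<^sub>p \<otimes> R\<^sup>* e\<^sub>p\<^sup>*\<close>: both sides have the matrix entries of \<open>R\<close> as coefficients
  (\<open>transpose2_casimir\<close>). The transpose of an arrow is an arrow by nondegeneracy of the pairing
  (\<open>pairing2_nondegenerate\<close>).

  The rest is multilinear algebra over carriers. The tensor product is a quotient of a free space,
  so its universal property (\<open>tensor_lift\<close>) comes from those of free spaces and quotients; maps out of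
  iterated tensor products are built by currying (\<open>bilinear_lift_left\<close>, \<open>bilinear_lift_right\<close>) and are
  compared on pure tensors (\<open>tensor_ext\<close> and its iterated forms). In this way every map that is
  specified by its values on pure tensors is shown to exist and to be linear, and the associativity,
  unit and exchange maps are shown to be bijective.
\<close>

section \<open>Vector spaces on carriers\<close>

abbreviation vspace :: "('k::field, 'v) module \<Rightarrow> bool" where
  "vspace V \<equiv> vectorspace class_ring V"

lemma vs_module: "vspace V \<Longrightarrow> module class_ring V"
  by (simp add: vectorspace_def)

lemma vs_abelian_group: "vspace V \<Longrightarrow> abelian_group V"
  using vs_module by (rule module.axioms(2))

lemma vs_abelian_monoid: "vspace V \<Longrightarrow> abelian_monoid V"
  by (simp add: vs_abelian_group abelian_group.axioms)

lemma vs_closed [simp]: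
  assumes "vspace V"
  shows "\<zero>\<^bsub>V\<^esub> \<in> carrier V"
    and "x \<in> carrier V \<Longrightarrow> y \<in> carrier V \<Longrightarrow> x \<oplus>\<^bsub>V\<^esub> y \<in> carrier V"
    and "x \<in> carrier V \<Longrightarrow> c \<odot>\<^bsub>V\<^esub> x \<in> carrier V"
    and "x \<in> carrier V \<Longrightarrow> \<ominus>\<^bsub>V\<^esub> x \<in> carrier V"
proof -
  interpret vectorspace class_ring V by fact
  show "\<zero>\<^bsub>V\<^esub> \<in> carrier V"
    and "x \<in> carrier V \<Longrightarrow> y \<in> carrier V \<Longrightarrow> x \<oplus>\<^bsub>V\<^esub> y \<in> carrier V"
    and "x \<in> carrier V \<Longrightarrow> c \<odot>\<^bsub>V\<^esub> x \<in> carrier V"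
    and "x \<in> carrier V \<Longrightarrow> \<ominus>\<^bsub>V\<^esub> x \<in> carrier V" by simp_all
qed

lemma vs_add:
  assumes "vspace V" and "x \<in> carrier V" and "y \<in> carrier V" and "z \<in> carrier V"
  shows vs_add_assoc: "(x \<oplus>\<^bsub>V\<^esub> y) \<oplus>\<^bsub>V\<^esub> z = x \<oplus>\<^bsub>V\<^esub> (y \<oplus>\<^bsub>V\<^esub> z)"
    and vs_add_left_commute: "x \<oplus>\<^bsub>V\<^esub> (y \<oplus>\<^bsub>V\<^esub> z) = y \<oplus>\<^bsub>V\<^esub> (x \<oplus>\<^bsub>V\<^esub> z)"
proof -
  interpret vectorspace class_ring V by fact
  show "(x \<oplus>\<^bsub>V\<^esub> y) \<oplus>\<^bsub>V\<^esub> z = x \<oplus>\<^bsub>V\<^esub> (y \<oplus>\<^bsub>V\<^esub> z)" "x \<oplus>\<^bsub>V\<^esub> (y \<oplus>\<^bsub>V\<^esub> z) = y \<oplus>\<^bsub>V\<^esub> (x \<oplus>\<^bsub>V\<^esub> z)"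
    using assms by (simp_all add: a_ac)
qed

lemma vs_add_commute:
  assumes "vspace V" and "x \<in> carrier V" and "y \<in> carrier V"
  shows "x \<oplus>\<^bsub>V\<^esub> y = y \<oplus>\<^bsub>V\<^esub> x"
proof -
  interpret vectorspace class_ring V by fact
  show ?thesis using assms by (simp add: a_ac)
qed

lemmas vs_ac = vs_add_assoc vs_add_left_commute vs_add_commute

lemma vs_smult:
  assumes "vspace V" and "x \<in> carrier V"
  shows vs_smult_add_left: "(a + b) \<odot>\<^bsub>V\<^esub> x = (a \<odot>\<^bsub>V\<^esub> x) \<oplus>\<^bsub>V\<^esub> (b \<odot>\<^bsub>V\<^esub> x)"
    and vs_smult_assoc: "(a * b) \<odot>\<^bsub>V\<^esub> x = a \<odot>\<^bsub>V\<^esub> (b \<odot>\<^bsub>V\<^esub> x)"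
    and vs_smult_one [simp]: "1 \<odot>\<^bsub>V\<^esub> x = x"
    and vs_smult_zero_left [simp]: "0 \<odot>\<^bsub>V\<^esub> x = \<zero>\<^bsub>V\<^esub>"
    and vs_neg: "\<ominus>\<^bsub>V\<^esub> x = (- 1) \<odot>\<^bsub>V\<^esub> x"
    and vs_add_zero [simp]: "x \<oplus>\<^bsub>V\<^esub> \<zero>\<^bsub>V\<^esub> = x" "\<zero>\<^bsub>V\<^esub> \<oplus>\<^bsub>V\<^esub> x = x"
    and vs_add_neg [simp]: "x \<oplus>\<^bsub>V\<^esub> \<ominus>\<^bsub>V\<^esub> x = \<zero>\<^bsub>V\<^esub>" "\<ominus>\<^bsub>V\<^esub> x \<oplus>\<^bsub>V\<^esub> x = \<zero>\<^bsub>V\<^esub>"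
proof -
  interpret vectorspace class_ring V by fact
  show "(a + b) \<odot>\<^bsub>V\<^esub> x = (a \<odot>\<^bsub>V\<^esub> x) \<oplus>\<^bsub>V\<^esub> (b \<odot>\<^bsub>V\<^esub> x)"
    using smult_l_distr[of a b x] assms by simp
  show "(a * b) \<odot>\<^bsub>V\<^esub> x = a \<odot>\<^bsub>V\<^esub> (b \<odot>\<^bsub>V\<^esub> x)"
    using smult_assoc1[of a b x] assms by simp
  show "1 \<odot>\<^bsub>V\<^esub> x = x" using smult_one[of x] assms by simp
  show "0 \<odot>\<^bsub>V\<^esub> x = \<zero>\<^bsub>V\<^esub>" using lmult_0[of x] assms by simp
  show "\<ominus>\<^bsub>V\<^esub> x = (- 1) \<odot>\<^bsub>V\<^esub> x" using smult_minus_1[of x] assms by (simp add: class_ring_simps)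
  show "x \<oplus>\<^bsub>V\<^esub> \<zero>\<^bsub>V\<^esub> = x" "\<zero>\<^bsub>V\<^esub> \<oplus>\<^bsub>V\<^esub> x = x" using assms by simp_all
  show "x \<oplus>\<^bsub>V\<^esub> \<ominus>\<^bsub>V\<^esub> x = \<zero>\<^bsub>V\<^esub>" "\<ominus>\<^bsub>V\<^esub> x \<oplus>\<^bsub>V\<^esub> x = \<zero>\<^bsub>V\<^esub>"
    using assms by (simp_all add: M.r_neg M.l_neg)
qed

lemma vs_smult_zero_right [simp]: "vspace V \<Longrightarrow> c \<odot>\<^bsub>V\<^esub> \<zero>\<^bsub>V\<^esub> = \<zero>\<^bsub>V\<^esub>"
  by (metis mult_zero_right vs_closed(1) vs_smult_assoc vs_smult_zero_left)

lemma vs_smult_add_right: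
  assumes "vspace V" and "x \<in> carrier V" and "y \<in> carrier V"
  shows "c \<odot>\<^bsub>V\<^esub> (x \<oplus>\<^bsub>V\<^esub> y) = (c \<odot>\<^bsub>V\<^esub> x) \<oplus>\<^bsub>V\<^esub> (c \<odot>\<^bsub>V\<^esub> y)"
proof -
  interpret vectorspace class_ring V by fact
  show ?thesis using smult_r_distr[of c x y] assms by simp
qed

text \<open>The additive inverse of \<open>x\<close> is \<open>(- 1) x\<close>, so it suffices to know that \<open>0 x\<close> is zero.\<close>

lemma vsI:
  fixes V :: "('k::field, 'v) module"
  assumes zero: "\<zero>\<^bsub>V\<^esub> \<in> carrier V"
    and add: "\<And>x y. x \<in> carrier V \<Longrightarrow> y \<in> carrier V \<Longrightarrow> x \<oplus>\<^bsub>V\<^esub> y \<in> carrier V"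
    and smult: "\<And>c x. x \<in> carrier V \<Longrightarrow> c \<odot>\<^bsub>V\<^esub> x \<in> carrier V"
    and comm: "\<And>x y. x \<in> carrier V \<Longrightarrow> y \<in> carrier V \<Longrightarrow> x \<oplus>\<^bsub>V\<^esub> y = y \<oplus>\<^bsub>V\<^esub> x"
    and assoc: "\<And>x y z. x \<in> carrier V \<Longrightarrow> y \<in> carrier V \<Longrightarrow> z \<in> carrier V
      \<Longrightarrow> (x \<oplus>\<^bsub>V\<^esub> y) \<oplus>\<^bsub>V\<^esub> z = x \<oplus>\<^bsub>V\<^esub> (y \<oplus>\<^bsub>V\<^esub> z)"
    and add_zero: "\<And>x. x \<in> carrier V \<Longrightarrow> x \<oplus>\<^bsub>V\<^esub> \<zero>\<^bsub>V\<^esub> = x"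
    and mult: "\<And>a b x. x \<in> carrier V \<Longrightarrow> (a * b) \<odot>\<^bsub>V\<^esub> x = a \<odot>\<^bsub>V\<^esub> (b \<odot>\<^bsub>V\<^esub> x)"
    and one: "\<And>x. x \<in> carrier V \<Longrightarrow> 1 \<odot>\<^bsub>V\<^esub> x = x"
    and smult_zero: "\<And>x. x \<in> carrier V \<Longrightarrow> 0 \<odot>\<^bsub>V\<^esub> x = \<zero>\<^bsub>V\<^esub>"
    and left: "\<And>a b x. x \<in> carrier V \<Longrightarrow> (a + b) \<odot>\<^bsub>V\<^esub> x = (a \<odot>\<^bsub>V\<^esub> x) \<oplus>\<^bsub>V\<^esub> (b \<odot>\<^bsub>V\<^esub> x)"
    and right: "\<And>c x y. x \<in> carrier V \<Longrightarrow> y \<in> carrier V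
      \<Longrightarrow> c \<odot>\<^bsub>V\<^esub> (x \<oplus>\<^bsub>V\<^esub> y) = (c \<odot>\<^bsub>V\<^esub> x) \<oplus>\<^bsub>V\<^esub> (c \<odot>\<^bsub>V\<^esub> y)"
  shows "vspace V"
proof -
  have neg: "\<exists>y\<in>carrier V. x \<oplus>\<^bsub>V\<^esub> y = \<zero>\<^bsub>V\<^esub>" if "x \<in> carrier V" for x
    using left[of x 1 "- 1"] that smult[of x "- 1"] by (intro bexI[of _ "(- 1) \<odot>\<^bsub>V\<^esub> x"])
      (simp_all add: one smult_zero)
  have "module class_ring V"
    by (rule module_criteria)
      (use assms neg in \<open>auto simp: class_cring.is_cring class_cring.cring_axioms\<close>)
  then show ?thesis
    by (simp add: vectorspace_def class_field)
qed

lemma linear_onI: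
  assumes "vspace V" "vspace W" "\<And>x. x \<in> carrier V \<Longrightarrow> f x \<in> carrier W"
    and "\<And>x y. x \<in> carrier V \<Longrightarrow> y \<in> carrier V \<Longrightarrow> f (x \<oplus>\<^bsub>V\<^esub> y) = f x \<oplus>\<^bsub>W\<^esub> f y"
    and "\<And>c x. x \<in> carrier V \<Longrightarrow> f (c \<odot>\<^bsub>V\<^esub> x) = c \<odot>\<^bsub>W\<^esub> f x"
  shows "linear_on V W f"
  using assms
  by (simp add: linear_map_def mod_hom_def mod_hom_axioms_def LinearCombinations.module_hom_def vs_module)

lemma linear_onD:
  assumes "linear_on V W f"
  shows linear_dom: "vspace V" and linear_cod: "vspace W"
    and linear_closed: "x \<in> carrier V \<Longrightarrow> f x \<in> carrier W"
    and linear_add: "x \<in> carrier V \<Longrightarrow> y \<in> carrier V \<Longrightarrow> f (x \<oplus>\<^bsub>V\<^esub> y) = f x \<oplus>\<^bsub>W\<^esub> f y"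
    and linear_smult: "x \<in> carrier V \<Longrightarrow> f (c \<odot>\<^bsub>V\<^esub> x) = c \<odot>\<^bsub>W\<^esub> f x"
    and linear_zero: "f \<zero>\<^bsub>V\<^esub> = \<zero>\<^bsub>W\<^esub>"
proof -
  interpret linear_map class_ring V W f by fact
  show "vspace V" "vspace W" by unfold_locales
  show "x \<in> carrier V \<Longrightarrow> f x \<in> carrier W"
    and "x \<in> carrier V \<Longrightarrow> y \<in> carrier V \<Longrightarrow> f (x \<oplus>\<^bsub>V\<^esub> y) = f x \<oplus>\<^bsub>W\<^esub> f y"
    and "x \<in> carrier V \<Longrightarrow> f (c \<odot>\<^bsub>V\<^esub> x) = c \<odot>\<^bsub>W\<^esub> f x"
    and "f \<zero>\<^bsub>V\<^esub> = \<zero>\<^bsub>W\<^esub>" by simp_all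
qed

lemma linear_on_cong:
  assumes "linear_on V W f" and "\<And>x. x \<in> carrier V \<Longrightarrow> g x = f x"
  shows "linear_on V W g"
  using assms(1) by (intro linear_onI) (simp_all add: assms(2) linear_onD)

lemma linear_compose:
  "linear_on V W f \<Longrightarrow> linear_on W U g \<Longrightarrow> linear_on V U (\<lambda>x. g (f x))"
  by (intro linear_onI) (simp_all add: linear_onD)

lemma linear_id: "vspace V \<Longrightarrow> linear_on V V (\<lambda>x. x)"
  by (intro linear_onI) simp_all

lemma linear_zero_map: "vspace V \<Longrightarrow> vspace W \<Longrightarrow> linear_on V W (\<lambda>_. \<zero>\<^bsub>W\<^esub>)"
  by (intro linear_onI) simp_all

lemma linear_add_map:
  assumes f: "linear_on V W f" and g: "linear_on V W g"
  shows "linear_on V W (\<lambda>x. f x \<oplus>\<^bsub>W\<^esub> g x)"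
  using linear_onD[OF f] linear_onD[OF g]
  by (intro linear_onI) (simp_all add: vs_ac vs_smult_add_right)

lemma linear_smult_map:
  assumes f: "linear_on V W f"
  shows "linear_on V W (\<lambda>x. c \<odot>\<^bsub>W\<^esub> f x)"
  using linear_onD[OF f]
  by (intro linear_onI) (simp_all add: vs_smult_add_right mult.commute flip: vs_smult_assoc)

lemma linear_neg_map:
  assumes f: "linear_on V W f"
  shows "linear_on V W (\<lambda>x. \<ominus>\<^bsub>W\<^esub> f x)"
  using linear_smult_map[OF f, of "- 1"]
  by (rule linear_on_cong) (simp add: vs_neg linear_onD[OF f])

text \<open>The inverses of the structural isomorphisms are chosen by \<open>inv_into\<close>. Exhibiting any linear
  two-sided inverse \<open>g\<close> identifies the chosen one with \<open>g\<close> on the carrier.\<close>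

lemma linear_inv_into:
  assumes f: "linear_on V W f" and inv: "\<And>x. x \<in> carrier V \<Longrightarrow> g (f x) = x"
    and g: "linear_on W V g" "\<And>y. y \<in> carrier W \<Longrightarrow> f (g y) = y"
  shows "linear_on W V (inv_into (carrier V) f)"
    and "\<And>y. y \<in> carrier W \<Longrightarrow> inv_into (carrier V) f y = g y"
proof -
  have inj: "inj_on f (carrier V)" by (metis inv inj_on_inverseI)
  show eq: "inv_into (carrier V) f y = g y" if "y \<in> carrier W" for y
    using inv_into_f_f[OF inj, of "g y"] that g linear_onD[OF g(1)] by simp
  show "linear_on W V (inv_into (carrier V) f)"
    using g(1) eq by (rule linear_on_cong)
qed

section \<open>Finite sums\<close>

lemma vs_finsum_closed [simp]:
  "vspace V \<Longrightarrow> (\<And>i. i \<in> I \<Longrightarrow> x i \<in> carrier V) \<Longrightarrow> (\<Oplus>\<^bsub>V\<^esub> i\<in>I. x i) \<in> carrier V"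
  by (intro abelian_monoid.finsum_closed vs_abelian_monoid) auto

lemma vs_finsum_cong:
  "vspace V \<Longrightarrow> (\<And>i. i \<in> I \<Longrightarrow> x i = y i) \<Longrightarrow> (\<And>i. i \<in> I \<Longrightarrow> y i \<in> carrier V)
    \<Longrightarrow> (\<Oplus>\<^bsub>V\<^esub> i\<in>I. x i) = (\<Oplus>\<^bsub>V\<^esub> i\<in>I. y i)"
  by (intro abelian_monoid.finsum_cong' vs_abelian_monoid) auto

lemma vs_finsum_empty [simp]: "vspace V \<Longrightarrow> (\<Oplus>\<^bsub>V\<^esub> i\<in>{}. x i) = \<zero>\<^bsub>V\<^esub>"
  by (intro abelian_monoid.finsum_empty vs_abelian_monoid)

lemma vs_finsum_insert:
  "vspace V \<Longrightarrow> finite I \<Longrightarrow> j \<notin> I \<Longrightarrow> x j \<in> carrier V \<Longrightarrow> (\<And>i. i \<in> I \<Longrightarrow> x i \<in> carrier V)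
    \<Longrightarrow> (\<Oplus>\<^bsub>V\<^esub> i\<in>insert j I. x i) = x j \<oplus>\<^bsub>V\<^esub> (\<Oplus>\<^bsub>V\<^esub> i\<in>I. x i)"
  by (intro abelian_monoid.finsum_insert vs_abelian_monoid) auto

lemma linear_finsum:
  assumes "linear_on V W f" and "\<And>i. i \<in> I \<Longrightarrow> x i \<in> carrier V"
  shows "f (\<Oplus>\<^bsub>V\<^esub> i\<in>I. x i) = (\<Oplus>\<^bsub>W\<^esub> i\<in>I. f (x i))"
proof (cases "finite I")
  case True
  from this assms(2) show ?thesis
    by (induction I rule: finite_induct)
      (simp_all add: linear_onD[OF assms(1)] vs_finsum_insert)
next
  case False
  then show ?thesis
    by (simp add: linear_onD[OF assms(1)] vs_abelian_monoid abelian_monoid.finsum_infinite)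
qed

lemma vs_finsum_add:
  assumes "vspace V" "\<And>i. i \<in> I \<Longrightarrow> x i \<in> carrier V" "\<And>i. i \<in> I \<Longrightarrow> y i \<in> carrier V"
  shows "(\<Oplus>\<^bsub>V\<^esub> i\<in>I. x i \<oplus>\<^bsub>V\<^esub> y i) = (\<Oplus>\<^bsub>V\<^esub> i\<in>I. x i) \<oplus>\<^bsub>V\<^esub> (\<Oplus>\<^bsub>V\<^esub> i\<in>I. y i)"
  using assms by (intro abelian_monoid.finsum_addf vs_abelian_monoid) auto

lemma vs_finsum_smult:
  assumes "vspace V" "\<And>i. i \<in> I \<Longrightarrow> x i \<in> carrier V"
  shows "c \<odot>\<^bsub>V\<^esub> (\<Oplus>\<^bsub>V\<^esub> i\<in>I. x i) = (\<Oplus>\<^bsub>V\<^esub> i\<in>I. c \<odot>\<^bsub>V\<^esub> x i)"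
  by (rule linear_finsum[OF linear_smult_map[OF linear_id]]) (use assms in auto)

lemma vs_finsum_zero [simp]: "vspace V \<Longrightarrow> (\<Oplus>\<^bsub>V\<^esub> i\<in>I. \<zero>\<^bsub>V\<^esub>) = \<zero>\<^bsub>V\<^esub>"
  by (intro abelian_monoid.finsum_zero vs_abelian_monoid)

lemma vs_finsum_swap:
  assumes "vspace V" "finite I" "finite J"
    and "\<And>i j. i \<in> I \<Longrightarrow> j \<in> J \<Longrightarrow> x i j \<in> carrier V"
  shows "(\<Oplus>\<^bsub>V\<^esub> i\<in>I. \<Oplus>\<^bsub>V\<^esub> j\<in>J. x i j) = (\<Oplus>\<^bsub>V\<^esub> j\<in>J. \<Oplus>\<^bsub>V\<^esub> i\<in>I. x i j)"
  using assms(2,4)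
proof (induction I rule: finite_induct)
  case empty
  then show ?case using assms by simp
next
  case (insert i I)
  then have "(\<Oplus>\<^bsub>V\<^esub> i\<in>insert i I. \<Oplus>\<^bsub>V\<^esub> j\<in>J. x i j)
      = (\<Oplus>\<^bsub>V\<^esub> j\<in>J. x i j) \<oplus>\<^bsub>V\<^esub> (\<Oplus>\<^bsub>V\<^esub> j\<in>J. \<Oplus>\<^bsub>V\<^esub> i\<in>I. x i j)"
    using assms(1) by (simp add: vs_finsum_insert)
  also have "\<dots> = (\<Oplus>\<^bsub>V\<^esub> j\<in>J. x i j \<oplus>\<^bsub>V\<^esub> (\<Oplus>\<^bsub>V\<^esub> i\<in>I. x i j))"
    using insert.prems assms(1) by (subst vs_finsum_add) auto
  also have "\<dots> = (\<Oplus>\<^bsub>V\<^esub> j\<in>J. \<Oplus>\<^bsub>V\<^esub> i\<in>insert i I. x i j)"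
    using insert assms(1) by (intro vs_finsum_cong) (auto simp: vs_finsum_insert)
  finally show ?case .
qed

lemma linear_finsum_map:
  assumes "vspace V" "vspace W" and "\<And>i. i \<in> I \<Longrightarrow> linear_on V W (f i)"
  shows "linear_on V W (\<lambda>x. \<Oplus>\<^bsub>W\<^esub> i\<in>I. f i x)"
  using assms linear_onD[OF assms(3)]
  by (intro linear_onI) (simp_all add: vs_finsum_add vs_finsum_smult cong: vs_finsum_cong)

lemma vs_finsum_product:
  assumes V: "vspace V" and "finite I" "finite J"
    and x: "\<And>i j. i \<in> I \<Longrightarrow> j \<in> J \<Longrightarrow> x i j \<in> carrier V"
  shows "(\<Oplus>\<^bsub>V\<^esub> i\<in>I. \<Oplus>\<^bsub>V\<^esub> j\<in>J. x i j) = (\<Oplus>\<^bsub>V\<^esub> p\<in>I \<times> J. x (fst p) (snd p))"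
  using assms(2) x
proof (induction I rule: finite_induct)
  case empty
  then show ?case using V by simp
next
  case (insert i I)
  interpret abelian_monoid V using V by (rule vs_abelian_monoid)
  have "insert i I \<times> J = Pair i ` J \<union> I \<times> J" by auto
  then have "(\<Oplus>\<^bsub>V\<^esub> p\<in>insert i I \<times> J. x (fst p) (snd p))
      = (\<Oplus>\<^bsub>V\<^esub> p\<in>Pair i ` J. x (fst p) (snd p)) \<oplus>\<^bsub>V\<^esub> (\<Oplus>\<^bsub>V\<^esub> p\<in>I \<times> J. x (fst p) (snd p))"
    using insert assms(3) by (simp only:) (rule finsum_Un_disjoint; auto)
  also have "(\<Oplus>\<^bsub>V\<^esub> p\<in>Pair i ` J. x (fst p) (snd p)) = (\<Oplus>\<^bsub>V\<^esub> j\<in>J. x i j)"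
    using insert.prems by (subst finsum_reindex) (auto simp: inj_on_def)
  finally show ?case
    using insert V by (simp add: vs_finsum_insert)
qed

lemma vs_finsum_delta:
  assumes "vspace V" "finite I" "j \<in> I" "\<And>i. i \<in> I \<Longrightarrow> x i \<in> carrier V"
  shows "(\<Oplus>\<^bsub>V\<^esub> i\<in>I. (if i = j then 1 else 0) \<odot>\<^bsub>V\<^esub> x i) = x j"
proof -
  have "(\<Oplus>\<^bsub>V\<^esub> i\<in>I. (if i = j then 1 else 0) \<odot>\<^bsub>V\<^esub> x i)
      = (\<Oplus>\<^bsub>V\<^esub> i\<in>insert j (I - {j}). (if i = j then 1 else 0) \<odot>\<^bsub>V\<^esub> x i)"
    using assms(3) by (simp add: insert_absorb)
  also have "\<dots> = x j \<oplus>\<^bsub>V\<^esub> (\<Oplus>\<^bsub>V\<^esub> i\<in>I - {j}. (if i = j then 1 else 0) \<odot>\<^bsub>V\<^esub> x i)"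
    using assms by (subst vs_finsum_insert) auto
  also have "(\<Oplus>\<^bsub>V\<^esub> i\<in>I - {j}. (if i = j then 1 else 0) \<odot>\<^bsub>V\<^esub> x i) = (\<Oplus>\<^bsub>V\<^esub> i\<in>I - {j}. \<zero>\<^bsub>V\<^esub>)"
    using assms by (intro vs_finsum_cong) auto
  finally show ?thesis using assms by simp
qed

section \<open>The ground field, quotients and free spaces\<close>

lemma ground_simps [simp]:
  "carrier ground = UNIV" "\<zero>\<^bsub>ground\<^esub> = 0" "add ground = (+)" "smult ground = (*)"
  by (simp_all add: ground_def)

lemma vs_ground [simp]: "vspace ground"
  by (rule vsI) (simp_all add: algebra_simps)

lemma finsum_ground [simp]: "(\<Oplus>\<^bsub>ground\<^esub> i\<in>I. x i) = (\<Sum>i\<in>I. x i)"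
proof (induction I rule: infinite_finite_induct)
  case (infinite I)
  then show ?case
    by (metis abelian_monoid.finsum_infinite ground_simps(2) sum.infinite vs_abelian_monoid vs_ground)
qed (simp_all add: vs_finsum_insert)

lemma linear_ground_scale: "linear_on V ground f \<Longrightarrow> linear_on V ground (\<lambda>x. f x * c)"
  "linear_on V ground f \<Longrightarrow> linear_on V ground (\<lambda>x. c * f x)"
  using linear_smult_map[of V ground f c] by (simp_all add: mult.commute)

lemma linear_scale_vector:
  assumes f: "linear_on V ground f" and "vspace W" "w \<in> carrier W"
  shows "linear_on V W (\<lambda>x. f x \<odot>\<^bsub>W\<^esub> w)"
  using assms linear_onD[OF f] by (intro linear_onI) (simp_all add: vs_smult_add_left vs_smult_assoc)

lemma linear_scale_point: "vspace V \<Longrightarrow> v \<in> carrier V \<Longrightarrow> linear_on ground V (\<lambda>c. c \<odot>\<^bsub>V\<^esub> v)"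
  by (rule linear_scale_vector[OF linear_id[OF vs_ground]])

context
  fixes M :: "('k::field, 'v) module" and N :: "'v set"
  assumes M [simp]: "vspace M" and N: "LinearCombinations.submodule class_ring N M"
begin

lemma submodule_mem:
  shows "x \<in> N \<Longrightarrow> x \<in> carrier M" "\<zero>\<^bsub>M\<^esub> \<in> N"
    and "x \<in> N \<Longrightarrow> y \<in> N \<Longrightarrow> x \<oplus>\<^bsub>M\<^esub> y \<in> N" "x \<in> N \<Longrightarrow> c \<odot>\<^bsub>M\<^esub> x \<in> N" "x \<in> N \<Longrightarrow> \<ominus>\<^bsub>M\<^esub> x \<in> N"
proof -
  interpret LinearCombinations.submodule class_ring N M by (fact N)
  show "x \<in> N \<Longrightarrow> x \<in> carrier M" "\<zero>\<^bsub>M\<^esub> \<in> N"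
    and "x \<in> N \<Longrightarrow> y \<in> N \<Longrightarrow> x \<oplus>\<^bsub>M\<^esub> y \<in> N" "x \<in> N \<Longrightarrow> c \<odot>\<^bsub>M\<^esub> x \<in> N"
    using subset by auto
  then show "x \<in> N \<Longrightarrow> \<ominus>\<^bsub>M\<^esub> x \<in> N" by (simp add: vs_neg smult_closed)
qed

lemma coset_mem: "y \<in> N +>\<^bsub>M\<^esub> x \<longleftrightarrow> (\<exists>n\<in>N. y = n \<oplus>\<^bsub>M\<^esub> x)"
  by (auto simp: a_r_coset_def')

lemma coset_eqI:
  assumes x: "x \<in> carrier M" and n: "n \<in> N"
  shows "N +>\<^bsub>M\<^esub> (n \<oplus>\<^bsub>M\<^esub> x) = N +>\<^bsub>M\<^esub> x"
proof (intro equalityI subsetI)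
  note nc = submodule_mem(1)[OF n]
  fix y assume "y \<in> N +>\<^bsub>M\<^esub> (n \<oplus>\<^bsub>M\<^esub> x)"
  then obtain m where m: "m \<in> N" "y = m \<oplus>\<^bsub>M\<^esub> (n \<oplus>\<^bsub>M\<^esub> x)" by (auto simp: coset_mem)
  then have "y = (m \<oplus>\<^bsub>M\<^esub> n) \<oplus>\<^bsub>M\<^esub> x"
    using x nc submodule_mem(1)[OF m(1)] by (simp add: vs_add_assoc)
  then show "y \<in> N +>\<^bsub>M\<^esub> x" using submodule_mem(3)[OF m(1) n] coset_mem by blast
next
  note nc = submodule_mem(1)[OF n]
  fix y assume "y \<in> N +>\<^bsub>M\<^esub> x"
  then obtain m where m: "m \<in> N" "y = m \<oplus>\<^bsub>M\<^esub> x" by (auto simp: coset_mem)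
  note mc = submodule_mem(1)[OF m(1)]
  have "y = m \<oplus>\<^bsub>M\<^esub> ((\<ominus>\<^bsub>M\<^esub> n \<oplus>\<^bsub>M\<^esub> n) \<oplus>\<^bsub>M\<^esub> x)"
    using x nc m by simp
  also have "\<dots> = (m \<oplus>\<^bsub>M\<^esub> \<ominus>\<^bsub>M\<^esub> n) \<oplus>\<^bsub>M\<^esub> (n \<oplus>\<^bsub>M\<^esub> x)"
    using x nc mc by (simp add: vs_add_assoc del: vs_add_neg)
  finally show "y \<in> N +>\<^bsub>M\<^esub> (n \<oplus>\<^bsub>M\<^esub> x)"
    using submodule_mem(3)[OF m(1) submodule_mem(5)[OF n]] coset_mem by blast
qed

lemma quotient_carrier: "carrier (quotient_vs M N) = (\<lambda>x. N +>\<^bsub>M\<^esub> x) ` carrier M"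
  by (auto simp: quotient_vs_def A_RCOSETS_def')

lemma quotient_add:
  assumes "x \<in> carrier M" "y \<in> carrier M"
  shows "(N +>\<^bsub>M\<^esub> x) \<oplus>\<^bsub>quotient_vs M N\<^esub> (N +>\<^bsub>M\<^esub> y) = N +>\<^bsub>M\<^esub> (x \<oplus>\<^bsub>M\<^esub> y)"
proof -
  have "abelian_subgroup N M"
    by (intro abelian_subgroupI3 additive_subgroup.intro vs_abelian_group M
        group.subgroupI abelian_group.a_group)
      (use submodule_mem in \<open>auto simp flip: a_inv_def\<close>)
  then show ?thesis using assms
    by (simp add: quotient_vs_def abelian_subgroup.a_rcos_sum)
qed

lemma quotient_smult:
  assumes [simp]: "x \<in> carrier M"
  shows "c \<odot>\<^bsub>quotient_vs M N\<^esub> (N +>\<^bsub>M\<^esub> x) = N +>\<^bsub>M\<^esub> (c \<odot>\<^bsub>M\<^esub> x)"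
proof -
  have 1: "m \<oplus>\<^bsub>M\<^esub> c \<odot>\<^bsub>M\<^esub> (n \<oplus>\<^bsub>M\<^esub> x) = (m \<oplus>\<^bsub>M\<^esub> c \<odot>\<^bsub>M\<^esub> n) \<oplus>\<^bsub>M\<^esub> c \<odot>\<^bsub>M\<^esub> x" if "m \<in> N" "n \<in> N" for m n
    using that[THEN submodule_mem(1)] by (simp add: vs_smult_add_right vs_add_assoc)
  have eq: "c \<odot>\<^bsub>quotient_vs M N\<^esub> (N +>\<^bsub>M\<^esub> x) = {m \<oplus>\<^bsub>M\<^esub> c \<odot>\<^bsub>M\<^esub> (n \<oplus>\<^bsub>M\<^esub> x) |m n. m \<in> N \<and> n \<in> N}"
    by (auto simp: quotient_vs_def set_add_def' a_r_coset_def')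
  show ?thesis
    unfolding eq
  proof (intro equalityI subsetI)
    fix y assume "y \<in> {m \<oplus>\<^bsub>M\<^esub> c \<odot>\<^bsub>M\<^esub> (n \<oplus>\<^bsub>M\<^esub> x) |m n. m \<in> N \<and> n \<in> N}"
    then show "y \<in> N +>\<^bsub>M\<^esub> (c \<odot>\<^bsub>M\<^esub> x)"
      by (auto simp: coset_mem 1) (metis submodule_mem(3,4))
  next
    fix y assume "y \<in> N +>\<^bsub>M\<^esub> (c \<odot>\<^bsub>M\<^esub> x)"
    then obtain m where "m \<in> N" "y = m \<oplus>\<^bsub>M\<^esub> c \<odot>\<^bsub>M\<^esub> (\<zero>\<^bsub>M\<^esub> \<oplus>\<^bsub>M\<^esub> x)" by (auto simp: coset_mem)
    then show "y \<in> {m \<oplus>\<^bsub>M\<^esub> c \<odot>\<^bsub>M\<^esub> (n \<oplus>\<^bsub>M\<^esub> x) |m n. m \<in> N \<and> n \<in> N}"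
      using submodule_mem(2) by blast
  qed
qed

lemma quotient_zero: "\<zero>\<^bsub>quotient_vs M N\<^esub> = N +>\<^bsub>M\<^esub> \<zero>\<^bsub>M\<^esub>"
  by (auto simp: quotient_vs_def coset_mem submodule_mem)

lemma vs_quotient: "vspace (quotient_vs M N)"
  by (rule vsI) (auto simp: quotient_carrier quotient_zero quotient_add quotient_smult
      vs_ac vs_smult_assoc vs_smult_add_left vs_smult_add_right)

lemma quotient_proj_linear: "linear_on M (quotient_vs M N) (\<lambda>x. N +>\<^bsub>M\<^esub> x)"
  by (rule linear_onI) (simp_all add: vs_quotient quotient_carrier quotient_add quotient_smult)

text \<open>A coset is sent to the value of \<open>F\<close> at an arbitrary representative; two representatives differ
  by an element of \<open>N\<close>, on which \<open>F\<close> vanishes.\<close>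

lemma quotient_lift:
  assumes F: "linear_on M U F" and null: "\<And>n. n \<in> N \<Longrightarrow> F n = \<zero>\<^bsub>U\<^esub>"
  shows "\<exists>f. linear_on (quotient_vs M N) U f \<and> (\<forall>x\<in>carrier M. f (N +>\<^bsub>M\<^esub> x) = F x)"
proof -
  define f where "f A = F (SOME x. x \<in> carrier M \<and> A = N +>\<^bsub>M\<^esub> x)" for A
  note lin = linear_onD[OF F]
  have f: "f (N +>\<^bsub>M\<^esub> x) = F x" if x: "x \<in> carrier M" for x
  proof -
    define y where "y = (SOME y. y \<in> carrier M \<and> N +>\<^bsub>M\<^esub> x = N +>\<^bsub>M\<^esub> y)"
    have y: "y \<in> carrier M \<and> N +>\<^bsub>M\<^esub> x = N +>\<^bsub>M\<^esub> y"
      unfolding y_def by (rule someI[of _ x]) (simp add: x)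
    have "x \<in> N +>\<^bsub>M\<^esub> x" using x submodule_mem(2) by (force simp: coset_mem)
    then obtain n where "n \<in> N" "x = n \<oplus>\<^bsub>M\<^esub> y" using y by (auto simp: coset_mem)
    then have "F x = F y" using y by (simp add: lin null submodule_mem(1))
    then show ?thesis by (simp add: f_def y_def)
  qed
  have "linear_on (quotient_vs M N) U f"
    by (rule linear_onI) (auto simp: vs_quotient quotient_carrier quotient_add quotient_smult f lin)
  then show ?thesis using f by blast
qed

end

lemma lookup_scale: "Poly_Mapping.lookup (Poly_Mapping.map ((*) (c::'k::field)) p) x = c * Poly_Mapping.lookup p x"
  by (simp add: Poly_Mapping.map.rep_eq when_def)

lemma free_simps [simp]:
  "carrier (free_vs X) = {p. Poly_Mapping.keys p \<subseteq> X}" "\<zero>\<^bsub>free_vs X\<^esub> = 0" "add (free_vs X) = (+)"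
  "smult (free_vs X) = (\<lambda>c. Poly_Mapping.map ((*) c))"
  by (simp_all add: free_vs_def)

lemma vs_free [simp]: "vspace (free_vs X)"
proof (rule vsI, goal_cases)
  case (2 x y)
  then show ?case using keys_add[of x y] by auto
next
  case (3 c x)
  then show ?case by (auto simp: in_keys_iff lookup_scale)
qed (auto intro!: poly_mapping_eqI simp: lookup_scale lookup_add algebra_simps)

text \<open>Single entries are added one at a time, which matches the way linear maps out of a free space
  are evaluated.\<close>

lemma free_induct [consumes 1, case_names zero add]:
  fixes p :: "'a \<Rightarrow>\<^sub>0 'k::field"
  assumes "Poly_Mapping.keys p \<subseteq> X" and "Q 0"
    and "\<And>c x q. x \<in> X \<Longrightarrow> Poly_Mapping.keys q \<subseteq> X \<Longrightarrow> Q q \<Longrightarrow> Q (Poly_Mapping.single x c + q)"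
  shows "Q p"
  using assms(1)
proof (induction p rule: update_induct)
  case const
  show ?case by (fact assms(2))
next
  case (update q x c)
  then have "Poly_Mapping.update x c q = Poly_Mapping.single x c + q"
    by (intro poly_mapping_eqI) (auto simp: lookup_update lookup_add lookup_single when_def in_keys_iff)
  moreover have "x \<in> X" "Poly_Mapping.keys q \<subseteq> X"
    using update by (auto simp: keys_update)
  ultimately show ?case using update assms(3) by auto
qed

text \<open>The extension is \<open>F p = \<Sum>\<^sub>x p(x) h(x)\<close> over the support of \<open>p\<close>. For additivity the two supports
  are different, so the sum is first enlarged to a common finite set.\<close>

lemma free_lift:
  fixes U :: "('k::field, 'u) module" and X :: "'a set"
  assumes U [simp]: "vspace U" and h [simp]: "\<And>x. x \<in> X \<Longrightarrow> h x \<in> carrier U"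
  shows "\<exists>F. linear_on (free_vs X :: ('k, 'a \<Rightarrow>\<^sub>0 'k) module) U F \<and> (\<forall>x\<in>X. F (Poly_Mapping.single x 1) = h x)"
proof -
  define G where "G K p = (\<Oplus>\<^bsub>U\<^esub> x\<in>K. Poly_Mapping.lookup p x \<odot>\<^bsub>U\<^esub> h x)" for K and p :: "'a \<Rightarrow>\<^sub>0 'k"
  define F where "F p = G (Poly_Mapping.keys p) p" for p
  have FG: "F p = G K p" if "finite K" "Poly_Mapping.keys p \<subseteq> K" "K \<subseteq> X" for K p
  proof -
    interpret abelian_monoid U by (simp add: vs_abelian_monoid)
    show ?thesis
      unfolding F_def G_def
      by (rule add.finprod_mono_neutral_cong_left[simplified])
        (use that in \<open>auto simp: in_keys_iff\<close>)
  qed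
  have "linear_on (free_vs X) U F"
  proof (rule linear_onI)
    fix p :: "'a \<Rightarrow>\<^sub>0 'k" assume p: "p \<in> carrier (free_vs X)"
    then show "F p \<in> carrier U" by (auto simp: F_def G_def intro!: vs_finsum_closed)
    show "F (c \<odot>\<^bsub>free_vs X\<^esub> p) = c \<odot>\<^bsub>U\<^esub> F p" for c
    proof -
      have "F (c \<odot>\<^bsub>free_vs X\<^esub> p) = G (Poly_Mapping.keys p) (c \<odot>\<^bsub>free_vs X\<^esub> p)"
        by (rule FG) (use p in \<open>auto simp: in_keys_iff lookup_scale\<close>)
      also have "\<dots> = c \<odot>\<^bsub>U\<^esub> F p"
        unfolding F_def G_def using p
        by (subst vs_finsum_smult) (auto intro!: vs_finsum_cong simp: lookup_scale vs_smult_assoc)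
      finally show ?thesis .
    qed
    fix q :: "'a \<Rightarrow>\<^sub>0 'k" assume q: "q \<in> carrier (free_vs X)"
    define K where "K = Poly_Mapping.keys p \<union> Poly_Mapping.keys q"
    have K: "finite K" "K \<subseteq> X" "Poly_Mapping.keys p \<subseteq> K" "Poly_Mapping.keys q \<subseteq> K"
      using p q by (auto simp: K_def)
    have "F (p \<oplus>\<^bsub>free_vs X\<^esub> q) = G K (p + q)"
      using FG[OF K(1) _ K(2), of "p + q"] keys_add[of p q] by (simp add: K_def)
    also have "\<dots> = G K p \<oplus>\<^bsub>U\<^esub> G K q"
      unfolding G_def using K(2)
      by (subst vs_finsum_add[symmetric])
        (auto intro!: vs_finsum_cong simp: lookup_add vs_smult_add_left subset_iff)
    finally show "F (p \<oplus>\<^bsub>free_vs X\<^esub> q) = F p \<oplus>\<^bsub>U\<^esub> F q" using FG K by simp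
  qed simp_all
  moreover have "F (Poly_Mapping.single x 1) = h x" if "x \<in> X" for x
    using that vs_finsum_insert[OF U, of "{}" x "\<lambda>y. Poly_Mapping.lookup (Poly_Mapping.single x 1) y \<odot>\<^bsub>U\<^esub> h y"]
    by (simp add: F_def G_def)
  ultimately show ?thesis by blast
qed

section \<open>The tensor product\<close>

lemma bilinear_onD:
  assumes "bilinear_on V W U \<beta>"
  shows "v \<in> carrier V \<Longrightarrow> linear_on W U (\<beta> v)" "w \<in> carrier W \<Longrightarrow> linear_on V U (\<lambda>v. \<beta> v w)"
  using assms by (auto simp: bilinear_on_def)

lemma bilinear_onI:
  assumes "\<And>v. v \<in> carrier V \<Longrightarrow> linear_on W U (\<beta> v)" "\<And>w. w \<in> carrier W \<Longrightarrow> linear_on V U (\<lambda>v. \<beta> v w)"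
  shows "bilinear_on V W U \<beta>"
  using assms by (auto simp: bilinear_on_def)

context
  fixes V :: "('k::field, 'v) module" and W :: "('k, 'w) module"
  assumes V [simp]: "vspace V" and W [simp]: "vspace W"
begin

private abbreviation (input) "F \<equiv> free_vs (carrier V \<times> carrier W) :: ('k, 'v \<times> 'w \<Rightarrow>\<^sub>0 'k) module"
private abbreviation (input) "e v w \<equiv> Poly_Mapping.single (v, w) (1::'k)"

text \<open>Each relator in the additive form \<open>lhs = r + rhs\<close>, which is how it acts both on cosets and on
  linear maps.\<close>

lemma tensor_relators_cases:
  assumes "r \<in> tensor_relators V W"
  obtains v v' w where "v \<in> carrier V" "v' \<in> carrier V" "w \<in> carrier W"
      "e (v \<oplus>\<^bsub>V\<^esub> v') w = r + (e v w + e v' w)"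
  | v w w' where "v \<in> carrier V" "w \<in> carrier W" "w' \<in> carrier W"
      "e v (w \<oplus>\<^bsub>W\<^esub> w') = r + (e v w + e v w')"
  | c v w where "v \<in> carrier V" "w \<in> carrier W"
      "e (c \<odot>\<^bsub>V\<^esub> v) w = r + Poly_Mapping.map ((*) c) (e v w)"
  | c v w where "v \<in> carrier V" "w \<in> carrier W"
      "e v (c \<odot>\<^bsub>W\<^esub> w) = r + Poly_Mapping.map ((*) c) (e v w)"
  using assms unfolding tensor_relators_def Let_def by (auto simp: algebra_simps) metis+

lemma tensor_relators_carrier: "tensor_relators V W \<subseteq> carrier F"
proof -
  have diff: "k \<in> Poly_Mapping.keys a \<or> k \<in> Poly_Mapping.keys b" if "k \<in> Poly_Mapping.keys (a - b)"
    for k and a b :: "'v \<times> 'w \<Rightarrow>\<^sub>0 'k"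
    using that by (auto simp: in_keys_iff lookup_minus)
  show ?thesis
    unfolding tensor_relators_def Let_def by (auto dest!: diff split: if_splits)
qed

lemma tensor_null_submodule: "LinearCombinations.submodule class_ring (tensor_null V W) F"
  unfolding tensor_null_def
  by (rule LinearCombinations.module.span_is_submodule)
    (simp_all add: vs_module tensor_relators_carrier del: free_simps)

lemma relator_null: "r \<in> tensor_relators V W \<Longrightarrow> r \<in> tensor_null V W"
  using LinearCombinations.module.in_own_span[OF vs_module[OF vs_free] tensor_relators_carrier]
  by (auto simp: tensor_null_def)

lemma vs_tensor [simp]: "vspace (tensor V W)"
  unfolding tensor_def by (rule vs_quotient[OF vs_free tensor_null_submodule])

lemma tensor_proj_linear: "linear_on F (tensor V W) (\<lambda>p. tensor_null V W +>\<^bsub>F\<^esub> p)"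
  unfolding tensor_def by (rule quotient_proj_linear[OF vs_free tensor_null_submodule])

lemma ptensor_closed [simp]:
  "v \<in> carrier V \<Longrightarrow> w \<in> carrier W \<Longrightarrow> ptensor V W v w \<in> carrier (tensor V W)"
  unfolding ptensor_def by (rule linear_closed[OF tensor_proj_linear]) simp

lemma tensor_coset_eqI:
  "p = r + q \<Longrightarrow> r \<in> tensor_relators V W \<Longrightarrow> q \<in> carrier F
    \<Longrightarrow> tensor_null V W +>\<^bsub>F\<^esub> p = tensor_null V W +>\<^bsub>F\<^esub> q"
  using coset_eqI[OF vs_free tensor_null_submodule, of q r] relator_null by simp

text \<open>The four families of relators are exactly the four bilinearity laws.\<close>

lemma ptensor_bilinear: "bilinear_on V W (tensor V W) (ptensor V W)"
proof (intro bilinear_onI linear_onI)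
  note lin = linear_add[OF tensor_proj_linear, symmetric] linear_smult[OF tensor_proj_linear, symmetric]
  fix v w assume [simp]: "v \<in> carrier V" "w \<in> carrier W"
  show "ptensor V W v (w \<oplus>\<^bsub>W\<^esub> w') = ptensor V W v w \<oplus>\<^bsub>tensor V W\<^esub> ptensor V W v w'"
    if [simp]: "w' \<in> carrier W" for w'
  proof -
    have "e v (w \<oplus>\<^bsub>W\<^esub> w') - e v w - e v w' \<in> tensor_relators V W"
      unfolding tensor_relators_def Let_def using that \<open>v \<in> carrier V\<close> \<open>w \<in> carrier W\<close> by blast
    from tensor_coset_eqI[OF _ this, of "e v (w \<oplus>\<^bsub>W\<^esub> w')" "e v w + e v w'"]
    show ?thesis
      using vs_closed(2)[OF vs_free, of "e v w" _ "e v w'"] lin(1)[of "e v w" "e v w'"]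
      by (simp add: ptensor_def)
  qed
  show "ptensor V W (v \<oplus>\<^bsub>V\<^esub> v') w = ptensor V W v w \<oplus>\<^bsub>tensor V W\<^esub> ptensor V W v' w"
    if [simp]: "v' \<in> carrier V" for v'
  proof -
    have "e (v \<oplus>\<^bsub>V\<^esub> v') w - e v w - e v' w \<in> tensor_relators V W"
      unfolding tensor_relators_def Let_def using that \<open>v \<in> carrier V\<close> \<open>w \<in> carrier W\<close> by blast
    from tensor_coset_eqI[OF _ this, of "e (v \<oplus>\<^bsub>V\<^esub> v') w" "e v w + e v' w"]
    show ?thesis
      using vs_closed(2)[OF vs_free, of "e v w" _ "e v' w"] lin(1)[of "e v w" "e v' w"]
      by (simp add: ptensor_def)
  qed
  show "ptensor V W v (c \<odot>\<^bsub>W\<^esub> w) = c \<odot>\<^bsub>tensor V W\<^esub> ptensor V W v w" for c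
  proof -
    have "e v (c \<odot>\<^bsub>W\<^esub> w) - Poly_Mapping.map ((*) c) (e v w) \<in> tensor_relators V W"
      unfolding tensor_relators_def Let_def using \<open>v \<in> carrier V\<close> \<open>w \<in> carrier W\<close> by blast
    from tensor_coset_eqI[OF _ this, of "e v (c \<odot>\<^bsub>W\<^esub> w)" "Poly_Mapping.single (v, w) c"]
    show ?thesis
      using lin(2)[of "e v w" c] by (simp add: ptensor_def)
  qed
  show "ptensor V W (c \<odot>\<^bsub>V\<^esub> v) w = c \<odot>\<^bsub>tensor V W\<^esub> ptensor V W v w" for c
  proof -
    have "e (c \<odot>\<^bsub>V\<^esub> v) w - Poly_Mapping.map ((*) c) (e v w) \<in> tensor_relators V W"
      unfolding tensor_relators_def Let_def using \<open>v \<in> carrier V\<close> \<open>w \<in> carrier W\<close> by blast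
    from tensor_coset_eqI[OF _ this, of "e (c \<odot>\<^bsub>V\<^esub> v) w" "Poly_Mapping.single (v, w) c"]
    show ?thesis
      using lin(2)[of "e v w" c] by (simp add: ptensor_def)
  qed
qed simp_all

lemmas ptensor_linear = bilinear_onD[OF ptensor_bilinear]

text \<open>Pure tensors and sums suffice: a scalar can be absorbed into the first factor, and zero is the
  pure tensor \<open>0 \<otimes> 0\<close>.\<close>

lemma tensor_induct [consumes 1, case_names pure add]:
  assumes t: "t \<in> carrier (tensor V W)"
    and pure: "\<And>v w. v \<in> carrier V \<Longrightarrow> w \<in> carrier W \<Longrightarrow> P (ptensor V W v w)"
    and add: "\<And>s t. s \<in> carrier (tensor V W) \<Longrightarrow> t \<in> carrier (tensor V W) \<Longrightarrow> P s \<Longrightarrow> P t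
      \<Longrightarrow> P (s \<oplus>\<^bsub>tensor V W\<^esub> t)"
  shows "P t"
proof -
  let ?N = "\<lambda>p. tensor_null V W +>\<^bsub>F\<^esub> p"
  note lin = linear_onD[OF tensor_proj_linear]
  obtain p where p: "Poly_Mapping.keys p \<subseteq> carrier V \<times> carrier W" "t = ?N p"
    using t by (auto simp: tensor_def quotient_carrier[OF vs_free tensor_null_submodule])
  have single: "P (?N (Poly_Mapping.single x c))" if "x \<in> carrier V \<times> carrier W" for x c
  proof -
    obtain v w where x: "x = (v, w)" "v \<in> carrier V" "w \<in> carrier W"
      using \<open>x \<in> _\<close> by (cases x) auto
    have "?N (Poly_Mapping.single x c) = c \<odot>\<^bsub>tensor V W\<^esub> ?N (e v w)"
      using lin(5)[of "e v w" c] x by simp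
    also have "\<dots> = ptensor V W (c \<odot>\<^bsub>V\<^esub> v) w"
      using x linear_smult[OF ptensor_linear(2)] by (simp add: ptensor_def)
    finally show ?thesis using pure x by simp
  qed
  have "P (?N p)" using p(1)
  proof (induction p rule: free_induct)
    case zero
    have "?N 0 = ptensor V W \<zero>\<^bsub>V\<^esub> \<zero>\<^bsub>W\<^esub>"
      using linear_zero[OF ptensor_linear(1), of "\<zero>\<^bsub>V\<^esub>"] lin(6) by simp
    then show ?case using pure by simp
  next
    case (add c x q)
    have "?N (Poly_Mapping.single x c + q) = ?N (Poly_Mapping.single x c) \<oplus>\<^bsub>tensor V W\<^esub> ?N q"
      using lin(4)[of "Poly_Mapping.single x c" q] add.hyps by simp
    then show ?case using add.hyps add.IH single assms(3) lin(3) by simp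
  qed
  then show ?thesis using p by simp
qed

text \<open>Bilinearity says that the extension of \<open>\<beta>\<close> to the free space kills the relators, hence their
  span, so it descends to the quotient.\<close>

lemma tensor_lift_exists:
  fixes U :: "('k, 'u) module"
  assumes [simp]: "vspace U" and \<beta>: "bilinear_on V W U \<beta>"
  shows "\<exists>f. linear_on (tensor V W) U f \<and>
    (\<forall>v\<in>carrier V. \<forall>w\<in>carrier W. f (ptensor V W v w) = \<beta> v w)"
proof -
  note lin1 = linear_onD[OF bilinear_onD(1)[OF \<beta>]] and lin2 = linear_onD[OF bilinear_onD(2)[OF \<beta>]]
  obtain h where h: "linear_on F U h" "\<forall>x\<in>carrier V \<times> carrier W. h (Poly_Mapping.single x 1) = \<beta> (fst x) (snd x)"
    using free_lift[of U "carrier V \<times> carrier W" "\<lambda>x. \<beta> (fst x) (snd x)"] lin1 by auto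
  note hlin = linear_onD[OF h(1)]
  interpret h: mod_hom class_ring F U h
    using h(1) by (simp add: linear_map_def)
  have "tensor_relators V W \<subseteq> h.ker"
  proof
    fix r assume r: "r \<in> tensor_relators V W"
    then have rc [simp]: "r \<in> carrier F" using tensor_relators_carrier by blast
    have cancel: "h r = \<zero>\<^bsub>U\<^esub>" if "p = r + q" "q \<in> carrier F" "h p = h q" for p q
    proof -
      have "h p = h r \<oplus>\<^bsub>U\<^esub> h q" using hlin(4)[OF rc that(2)] that(1) by simp
      then show ?thesis using that
        by (metis abelian_group.l_neg abelian_group.r_neg hlin(3) rc vs_abelian_group
            assms(1) vs_add_assoc vs_add_zero(1) vs_closed(4))
    qed
    from r have "h r = \<zero>\<^bsub>U\<^esub>"
    proof (cases rule: tensor_relators_cases)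
      case (1 v v' w)
      show ?thesis
        by (rule cancel[OF 1(4)]) (use 1(1-3) hlin(4)[of "e v w" "e v' w"] h(2) vs_closed(2)[OF vs_free, of "e v w" _ "e v' w"] in \<open>simp_all add: lin2\<close>)
    next
      case (2 v w w')
      show ?thesis
        by (rule cancel[OF 2(4)]) (use 2(1-3) hlin(4)[of "e v w" "e v w'"] h(2) vs_closed(2)[OF vs_free, of "e v w" _ "e v w'"] in \<open>simp_all add: lin1\<close>)
    next
      case (3 c v w)
      show ?thesis
        by (rule cancel[OF 3(3)]) (use 3(1-2) hlin(5)[of "e v w" c] h(2) in \<open>simp_all add: lin2\<close>)
    next
      case (4 c v w)
      show ?thesis
        by (rule cancel[OF 4(3)]) (use 4(1-2) hlin(5)[of "e v w" c] h(2) in \<open>simp_all add: lin1\<close>)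
    qed
    then show "r \<in> h.ker" by (simp add: h.ker_def del: free_simps)
  qed
  then have "tensor_null V W \<subseteq> h.ker"
    unfolding tensor_null_def
    by (intro LinearCombinations.module.span_is_subset h.ker_is_submodule vs_module vs_free)
  then have "\<exists>f. linear_on (tensor V W) U f \<and> (\<forall>p\<in>carrier F. f (tensor_null V W +>\<^bsub>F\<^esub> p) = h p)"
    unfolding tensor_def
    by (intro quotient_lift[OF vs_free tensor_null_submodule h(1)]) (auto simp: h.ker_def)
  then show ?thesis using h(2) by (auto simp: ptensor_def)
qed

lemma tensor_lift:
  assumes "vspace U" and "bilinear_on V W U \<beta>"
  shows tensor_lift_linear: "linear_on (tensor V W) U (tensor_lift V W U \<beta>)"
    and tensor_lift_pure:
      "v \<in> carrier V \<Longrightarrow> w \<in> carrier W \<Longrightarrow> tensor_lift V W U \<beta> (ptensor V W v w) = \<beta> v w"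
  using someI_ex[OF tensor_lift_exists[OF assms]] by (auto simp: tensor_lift_def)

lemma tensor_ext:
  assumes "linear_on (tensor V W) U f" "linear_on (tensor V W) U g"
    and "\<And>v w. v \<in> carrier V \<Longrightarrow> w \<in> carrier W \<Longrightarrow> f (ptensor V W v w) = g (ptensor V W v w)"
    and "t \<in> carrier (tensor V W)"
  shows "f t = g t"
  using assms(4)
  by (induction t rule: tensor_induct) (simp_all add: assms(3) assms(1,2)[THEN linear_add])

end

lemma ptensor_smult:
  assumes "vspace V" "vspace W" "v \<in> carrier V" "w \<in> carrier W"
  shows "ptensor V W (c \<odot>\<^bsub>V\<^esub> v) w = c \<odot>\<^bsub>tensor V W\<^esub> ptensor V W v w"
    and "ptensor V W v (c \<odot>\<^bsub>W\<^esub> w) = c \<odot>\<^bsub>tensor V W\<^esub> ptensor V W v w"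
  using linear_smult[OF ptensor_linear(1)[OF assms(1-3)] assms(4)]
    linear_smult[OF ptensor_linear(2)[OF assms(1,2,4)] assms(3)] by auto

lemma ptensor_smult_both:
  assumes "vspace V" "vspace W" "v \<in> carrier V" "w \<in> carrier W"
  shows "ptensor V W (c \<odot>\<^bsub>V\<^esub> v) (d \<odot>\<^bsub>W\<^esub> w) = (c * d) \<odot>\<^bsub>tensor V W\<^esub> ptensor V W v w"
  using assms by (subst ptensor_smult(1)) (simp_all add: ptensor_smult(2) vs_smult_assoc)

text \<open>The sum is indexed by pairs, so that double sums over a basis behave like single sums over the
  product basis.\<close>

lemma ptensor_finsum:
  assumes [simp]: "vspace V" "vspace W" "finite I" "finite J"
    and x [simp]: "\<And>i. i \<in> I \<Longrightarrow> x i \<in> carrier V" and y [simp]: "\<And>j. j \<in> J \<Longrightarrow> y j \<in> carrier W"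
  shows "ptensor V W (\<Oplus>\<^bsub>V\<^esub> i\<in>I. x i) (\<Oplus>\<^bsub>W\<^esub> j\<in>J. y j)
    = (\<Oplus>\<^bsub>tensor V W\<^esub> p\<in>I \<times> J. ptensor V W (x (fst p)) (y (snd p)))"
proof -
  have "ptensor V W (\<Oplus>\<^bsub>V\<^esub> i\<in>I. x i) (\<Oplus>\<^bsub>W\<^esub> j\<in>J. y j)
      = (\<Oplus>\<^bsub>tensor V W\<^esub> i\<in>I. ptensor V W (x i) (\<Oplus>\<^bsub>W\<^esub> j\<in>J. y j))"
    by (rule linear_finsum[OF ptensor_linear(2)]) simp_all
  also have "\<dots> = (\<Oplus>\<^bsub>tensor V W\<^esub> i\<in>I. \<Oplus>\<^bsub>tensor V W\<^esub> j\<in>J. ptensor V W (x i) (y j))"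
    by (intro vs_finsum_cong linear_finsum[OF ptensor_linear(1)] vs_finsum_closed) simp_all
  finally show ?thesis by (simp add: vs_finsum_product)
qed

section \<open>Iterated tensor products\<close>

text \<open>The form of the induction rule for use with arbitrary spaces: the two vector space hypotheses
  are consumed together with the membership of \<open>t\<close>.\<close>

lemmas tensor_elem_induct = tensor_induct [consumes 3, case_names pure add]

lemma linear_ptensor_left:
  assumes f: "linear_on U V f" and "vspace W" "w \<in> carrier W"
  shows "linear_on U (tensor V W) (\<lambda>x. ptensor V W (f x) w)"
  by (rule linear_compose[OF f ptensor_linear(2)]) (use assms linear_cod[OF f] in simp_all)

lemma linear_ptensor_right:
  assumes f: "linear_on U W f" and "vspace V" "v \<in> carrier V"
  shows "linear_on U (tensor V W) (\<lambda>x. ptensor V W v (f x))"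
  by (rule linear_compose[OF f ptensor_linear(1)]) (use assms linear_cod[OF f] in simp_all)

lemma tensor_map:
  assumes k: "linear_on V V' k" and l: "linear_on W W' l"
  shows tensor_map_linear: "linear_on (tensor V W) (tensor V' W') (tensor_map V W V' W' k l)"
    and tensor_map_pure: "v \<in> carrier V \<Longrightarrow> w \<in> carrier W
      \<Longrightarrow> tensor_map V W V' W' k l (ptensor V W v w) = ptensor V' W' (k v) (l w)"
proof -
  note kl = linear_onD[OF k] linear_onD[OF l]
  have "bilinear_on V W (tensor V' W') (\<lambda>v w. ptensor V' W' (k v) (l w))"
    by (intro bilinear_onI linear_ptensor_left linear_ptensor_right k l kl)
  from tensor_lift[OF kl(1) kl(7) _ this] kl
  show "linear_on (tensor V W) (tensor V' W') (tensor_map V W V' W' k l)"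
    and "v \<in> carrier V \<Longrightarrow> w \<in> carrier W
      \<Longrightarrow> tensor_map V W V' W' k l (ptensor V W v w) = ptensor V' W' (k v) (l w)"
    by (simp_all add: tensor_map_def)
qed

text \<open>Currying: a family of bilinear maps depending linearly on a parameter \<open>u\<close> lifts to a family of
  linear maps depending linearly on \<open>u\<close>. Linearity in \<open>u\<close> holds for pure tensors \<open>t\<close> by hypothesis and
  is preserved by sums.\<close>

lemma bilinear_lift_left:
  assumes [simp]: "vspace V" "vspace W" "vspace U" "vspace X"
    and vw: "\<And>u. u \<in> carrier U \<Longrightarrow> bilinear_on V W X (\<lambda>v w. \<tau> v w u)"
    and u: "\<And>v w. v \<in> carrier V \<Longrightarrow> w \<in> carrier W \<Longrightarrow> linear_on U X (\<tau> v w)"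
  shows "bilinear_on (tensor V W) U X (\<lambda>t u. tensor_lift V W X (\<lambda>v w. \<tau> v w u) t)"
proof (rule bilinear_onI)
  note lift = tensor_lift_linear[OF assms(1,2,4) vw] and lift_pure = tensor_lift_pure[OF assms(1,2,4) vw]
  show "linear_on (tensor V W) X (tensor_lift V W X (\<lambda>v w. \<tau> v w u))" if "u \<in> carrier U" for u
    by (rule lift) fact
  fix t assume "t \<in> carrier (tensor V W)"
  with assms(1,2) show "linear_on U X (\<lambda>u. tensor_lift V W X (\<lambda>v w. \<tau> v w u) t)"
  proof (induction t rule: tensor_elem_induct)
    case (pure v w)
    then show ?case by (intro linear_on_cong[OF u]) (simp_all add: lift_pure)
  next
    case (add s t)
    show ?case
      by (rule linear_on_cong[OF linear_add_map[OF add.IH]]) (rule linear_add[OF lift add.hyps])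
  qed
qed

lemma bilinear_lift_right:
  assumes [simp]: "vspace V" "vspace W" "vspace U" "vspace X"
    and wu: "\<And>v. v \<in> carrier V \<Longrightarrow> bilinear_on W U X (\<tau> v)"
    and v: "\<And>w u. w \<in> carrier W \<Longrightarrow> u \<in> carrier U \<Longrightarrow> linear_on V X (\<lambda>v. \<tau> v w u)"
  shows "bilinear_on V (tensor W U) X (\<lambda>v. tensor_lift W U X (\<tau> v))"
proof (rule bilinear_onI)
  note lift = tensor_lift_linear[OF assms(2-4) wu] and lift_pure = tensor_lift_pure[OF assms(2-4) wu]
  show "linear_on (tensor W U) X (tensor_lift W U X (\<tau> v))" if "v \<in> carrier V" for v
    by (rule lift) fact
  fix t assume "t \<in> carrier (tensor W U)"
  with assms(2,3) show "linear_on V X (\<lambda>v. tensor_lift W U X (\<tau> v) t)"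
  proof (induction t rule: tensor_elem_induct)
    case (pure w u)
    then show ?case by (intro linear_on_cong[OF v]) (simp_all add: lift_pure)
  next
    case (add s t)
    show ?case
      by (rule linear_on_cong[OF linear_add_map[OF add.IH]]) (rule linear_add[OF lift add.hyps])
  qed
qed

lemma trilinear_lift_left:
  assumes [simp]: "vspace V" "vspace W" "vspace U" "vspace X"
    and v: "\<And>w u. w \<in> carrier W \<Longrightarrow> u \<in> carrier U \<Longrightarrow> linear_on V X (\<lambda>v. \<tau> v w u)"
    and w: "\<And>v u. v \<in> carrier V \<Longrightarrow> u \<in> carrier U \<Longrightarrow> linear_on W X (\<lambda>w. \<tau> v w u)"
    and u: "\<And>v w. v \<in> carrier V \<Longrightarrow> w \<in> carrier W \<Longrightarrow> linear_on U X (\<lambda>u. \<tau> v w u)"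
  shows "\<exists>f. linear_on (tensor (tensor V W) U) X f \<and>
    (\<forall>v\<in>carrier V. \<forall>w\<in>carrier W. \<forall>u\<in>carrier U.
      f (ptensor (tensor V W) U (ptensor V W v w) u) = \<tau> v w u)"
proof -
  have vw: "bilinear_on V W X (\<lambda>v w. \<tau> v w u)" if "u \<in> carrier U" for u
    using that by (intro bilinear_onI v w)
  have "bilinear_on (tensor V W) U X (\<lambda>t u. tensor_lift V W X (\<lambda>v w. \<tau> v w u) t)"
    by (rule bilinear_lift_left) (simp_all add: vw u)
  from tensor_lift[OF _ _ _ this] show ?thesis
    by (intro exI[of _ "tensor_lift (tensor V W) U X (\<lambda>t u. tensor_lift V W X (\<lambda>v w. \<tau> v w u) t)"])
      (simp add: tensor_lift_pure[OF _ _ _ vw])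
qed

lemma trilinear_lift_right:
  assumes [simp]: "vspace V" "vspace W" "vspace U" "vspace X"
    and v: "\<And>w u. w \<in> carrier W \<Longrightarrow> u \<in> carrier U \<Longrightarrow> linear_on V X (\<lambda>v. \<tau> v w u)"
    and w: "\<And>v u. v \<in> carrier V \<Longrightarrow> u \<in> carrier U \<Longrightarrow> linear_on W X (\<lambda>w. \<tau> v w u)"
    and u: "\<And>v w. v \<in> carrier V \<Longrightarrow> w \<in> carrier W \<Longrightarrow> linear_on U X (\<lambda>u. \<tau> v w u)"
  shows "\<exists>f. linear_on (tensor V (tensor W U)) X f \<and>
    (\<forall>v\<in>carrier V. \<forall>w\<in>carrier W. \<forall>u\<in>carrier U.
      f (ptensor V (tensor W U) v (ptensor W U w u)) = \<tau> v w u)"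
proof -
  have wu: "bilinear_on W U X (\<tau> v)" if "v \<in> carrier V" for v
    using that by (intro bilinear_onI u w)
  have "bilinear_on V (tensor W U) X (\<lambda>v. tensor_lift W U X (\<tau> v))"
    by (rule bilinear_lift_right) (simp_all add: wu v)
  from tensor_lift[OF _ _ _ this] show ?thesis
    by (intro exI[of _ "tensor_lift V (tensor W U) X (\<lambda>v. tensor_lift W U X (\<tau> v))"])
      (simp add: tensor_lift_pure[OF _ _ _ wu])
qed

text \<open>First lift in the last two variables; the result is trilinear in \<open>a\<close>, \<open>b\<close> and an element of
  \<open>C \<otimes> D\<close> by currying.\<close>

lemma quadrilinear_lift:
  assumes [simp]: "vspace A" "vspace B" "vspace C" "vspace D" "vspace X"
    and a: "\<And>b c d. b \<in> carrier B \<Longrightarrow> c \<in> carrier C \<Longrightarrow> d \<in> carrier D \<Longrightarrow> linear_on A X (\<lambda>a. \<tau> a b c d)"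
    and b: "\<And>a c d. a \<in> carrier A \<Longrightarrow> c \<in> carrier C \<Longrightarrow> d \<in> carrier D \<Longrightarrow> linear_on B X (\<lambda>b. \<tau> a b c d)"
    and c: "\<And>a b d. a \<in> carrier A \<Longrightarrow> b \<in> carrier B \<Longrightarrow> d \<in> carrier D \<Longrightarrow> linear_on C X (\<lambda>c. \<tau> a b c d)"
    and d: "\<And>a b c. a \<in> carrier A \<Longrightarrow> b \<in> carrier B \<Longrightarrow> c \<in> carrier C \<Longrightarrow> linear_on D X (\<lambda>d. \<tau> a b c d)"
  shows "\<exists>f. linear_on (tensor (tensor A B) (tensor C D)) X f \<and>
    (\<forall>a\<in>carrier A. \<forall>b\<in>carrier B. \<forall>c\<in>carrier C. \<forall>d\<in>carrier D.
      f (ptensor (tensor A B) (tensor C D) (ptensor A B a b) (ptensor C D c d)) = \<tau> a b c d)"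
proof -
  let ?\<sigma> = "\<lambda>a b. tensor_lift C D X (\<tau> a b)"
  have cd: "bilinear_on C D X (\<tau> a b)" if "a \<in> carrier A" "b \<in> carrier B" for a b
    using that by (intro bilinear_onI c d)
  have 1: "bilinear_on A (tensor C D) X (\<lambda>a. ?\<sigma> a b)" if "b \<in> carrier B" for b
    using that by (intro bilinear_lift_right) (simp_all add: cd a)
  have 2: "bilinear_on B (tensor C D) X (?\<sigma> a)" if "a \<in> carrier A" for a
    using that by (intro bilinear_lift_right) (simp_all add: cd b)
  have "\<exists>f. linear_on (tensor (tensor A B) (tensor C D)) X f \<and>
    (\<forall>a\<in>carrier A. \<forall>b\<in>carrier B. \<forall>u\<in>carrier (tensor C D).
      f (ptensor (tensor A B) (tensor C D) (ptensor A B a b) u) = ?\<sigma> a b u)"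
    by (rule trilinear_lift_left) (simp_all add: bilinear_onD[OF 1] bilinear_onD[OF 2])
  then obtain f where "linear_on (tensor (tensor A B) (tensor C D)) X f"
    "\<forall>a\<in>carrier A. \<forall>b\<in>carrier B. \<forall>u\<in>carrier (tensor C D).
      f (ptensor (tensor A B) (tensor C D) (ptensor A B a b) u) = ?\<sigma> a b u"
    by blast
  then show ?thesis
    by (intro exI[of _ f]) (simp add: tensor_lift_pure[OF _ _ _ cd])
qed

lemma tensor_ext_left:
  assumes [simp]: "vspace V" "vspace W" "vspace U"
    and f: "linear_on (tensor (tensor V W) U) X f" and g: "linear_on (tensor (tensor V W) U) X g"
    and eq: "\<And>v w u. v \<in> carrier V \<Longrightarrow> w \<in> carrier W \<Longrightarrow> u \<in> carrier U
      \<Longrightarrow> f (ptensor (tensor V W) U (ptensor V W v w) u) = g (ptensor (tensor V W) U (ptensor V W v w) u)"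
    and x: "x \<in> carrier (tensor (tensor V W) U)"
  shows "f x = g x"
proof (rule tensor_ext[OF _ _ f g _ x])
  fix t u assume t: "t \<in> carrier (tensor V W)" and u: "u \<in> carrier U"
  note lin = linear_compose[OF linear_ptensor_left[OF linear_id \<open>vspace U\<close> u]]
  show "f (ptensor (tensor V W) U t u) = g (ptensor (tensor V W) U t u)"
    by (rule tensor_ext[OF _ _ lin[OF _ f] lin[OF _ g] eq t]) (simp_all add: u)
qed simp_all

lemma tensor_ext_right:
  assumes [simp]: "vspace V" "vspace W" "vspace U"
    and f: "linear_on (tensor V (tensor W U)) X f" and g: "linear_on (tensor V (tensor W U)) X g"
    and eq: "\<And>v w u. v \<in> carrier V \<Longrightarrow> w \<in> carrier W \<Longrightarrow> u \<in> carrier U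
      \<Longrightarrow> f (ptensor V (tensor W U) v (ptensor W U w u)) = g (ptensor V (tensor W U) v (ptensor W U w u))"
    and x: "x \<in> carrier (tensor V (tensor W U))"
  shows "f x = g x"
proof (rule tensor_ext[OF _ _ f g _ x])
  fix v t assume v: "v \<in> carrier V" and t: "t \<in> carrier (tensor W U)"
  note lin = linear_compose[OF linear_ptensor_right[OF linear_id \<open>vspace V\<close> v]]
  show "f (ptensor V (tensor W U) v t) = g (ptensor V (tensor W U) v t)"
    by (rule tensor_ext[OF _ _ lin[OF _ f] lin[OF _ g] eq t]) (simp_all add: v)
qed simp_all

lemma tensor_ext_both:
  assumes [simp]: "vspace A" "vspace B" "vspace C" "vspace D"
    and f: "linear_on (tensor (tensor A B) (tensor C D)) X f"
    and g: "linear_on (tensor (tensor A B) (tensor C D)) X g"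
    and eq: "\<And>a b c d. a \<in> carrier A \<Longrightarrow> b \<in> carrier B \<Longrightarrow> c \<in> carrier C \<Longrightarrow> d \<in> carrier D
      \<Longrightarrow> f (ptensor (tensor A B) (tensor C D) (ptensor A B a b) (ptensor C D c d))
        = g (ptensor (tensor A B) (tensor C D) (ptensor A B a b) (ptensor C D c d))"
    and x: "x \<in> carrier (tensor (tensor A B) (tensor C D))"
  shows "f x = g x"
proof (rule tensor_ext_left[OF _ _ _ f g _ x])
  fix a b t assume ab: "a \<in> carrier A" "b \<in> carrier B" and t: "t \<in> carrier (tensor C D)"
  have p: "ptensor A B a b \<in> carrier (tensor A B)" using ab by simp
  note lin = linear_compose[OF linear_ptensor_right[OF linear_id _ p]]
  show "f (ptensor (tensor A B) (tensor C D) (ptensor A B a b) t)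
      = g (ptensor (tensor A B) (tensor C D) (ptensor A B a b) t)"
    by (rule tensor_ext[OF _ _ lin[OF _ _ f] lin[OF _ _ g] eq t]) (simp_all add: ab)
qed simp_all

section \<open>Structural isomorphisms\<close>

lemma assoc:
  assumes [simp]: "vspace V" "vspace W" "vspace U"
  shows assoc_linear: "linear_on (tensor (tensor V W) U) (tensor V (tensor W U)) (assoc V W U)"
    and assoc_pure: "v \<in> carrier V \<Longrightarrow> w \<in> carrier W \<Longrightarrow> u \<in> carrier U
      \<Longrightarrow> assoc V W U (ptensor (tensor V W) U (ptensor V W v w) u) = ptensor V (tensor W U) v (ptensor W U w u)"
    and assoc_inv_linear: "linear_on (tensor V (tensor W U)) (tensor (tensor V W) U) (assoc_inv V W U)"
    and assoc_inv_pure: "v \<in> carrier V \<Longrightarrow> w \<in> carrier W \<Longrightarrow> u \<in> carrier U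
      \<Longrightarrow> assoc_inv V W U (ptensor V (tensor W U) v (ptensor W U w u)) = ptensor (tensor V W) U (ptensor V W v w) u"
proof -
  have ex: "\<exists>f. linear_on (tensor (tensor V W) U) (tensor V (tensor W U)) f \<and>
     (\<forall>v\<in>carrier V. \<forall>w\<in>carrier W. \<forall>u\<in>carrier U.
        f (ptensor (tensor V W) U (ptensor V W v w) u) = ptensor V (tensor W U) v (ptensor W U w u))"
    by (rule trilinear_lift_left)
      (simp_all add: linear_ptensor_left linear_ptensor_right linear_id)
  from someI_ex[OF this, folded assoc_def]
  show lin: "linear_on (tensor (tensor V W) U) (tensor V (tensor W U)) (assoc V W U)"
    and pure: "v \<in> carrier V \<Longrightarrow> w \<in> carrier W \<Longrightarrow> u \<in> carrier U
      \<Longrightarrow> assoc V W U (ptensor (tensor V W) U (ptensor V W v w) u) = ptensor V (tensor W U) v (ptensor W U w u)"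
    for v w u by auto
  have "\<exists>f. linear_on (tensor V (tensor W U)) (tensor (tensor V W) U) f \<and>
     (\<forall>v\<in>carrier V. \<forall>w\<in>carrier W. \<forall>u\<in>carrier U.
        f (ptensor V (tensor W U) v (ptensor W U w u)) = ptensor (tensor V W) U (ptensor V W v w) u)"
    by (rule trilinear_lift_right)
      (simp_all add: linear_ptensor_left linear_ptensor_right linear_id)
  then obtain g where g: "linear_on (tensor V (tensor W U)) (tensor (tensor V W) U) g"
    "\<And>v w u. v \<in> carrier V \<Longrightarrow> w \<in> carrier W \<Longrightarrow> u \<in> carrier U
      \<Longrightarrow> g (ptensor V (tensor W U) v (ptensor W U w u)) = ptensor (tensor V W) U (ptensor V W v w) u"
    by blast
  have gf: "g (assoc V W U x) = x" if "x \<in> carrier (tensor (tensor V W) U)" for x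
    by (rule tensor_ext_left[OF _ _ _ linear_compose[OF lin g(1)] linear_id _ that]) (simp_all add: pure g)
  have fg: "assoc V W U (g x) = x" if "x \<in> carrier (tensor V (tensor W U))" for x
    by (rule tensor_ext_right[OF _ _ _ linear_compose[OF g(1) lin] linear_id _ that]) (simp_all add: pure g)
  note inv = linear_inv_into[OF lin gf g(1) fg]
  show "linear_on (tensor V (tensor W U)) (tensor (tensor V W) U) (assoc_inv V W U)"
    by (rule inv(1)) 
  show "assoc_inv V W U (ptensor V (tensor W U) v (ptensor W U w u)) = ptensor (tensor V W) U (ptensor V W v w) u"
    if "v \<in> carrier V" "w \<in> carrier W" "u \<in> carrier U"
    using that by (simp add: inv(2) g)
qed

text \<open>Injectivity is recorded because it lets equations in \<open>k \<otimes> V\<close> be tested in \<open>V\<close>.\<close>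

lemma lunit:
  assumes [simp]: "vspace V"
  shows lunit_linear: "linear_on (tensor ground V) V (lunit V)"
    and lunit_pure: "v \<in> carrier V \<Longrightarrow> lunit V (ptensor ground V c v) = c \<odot>\<^bsub>V\<^esub> v"
    and lunit_inv: "v \<in> carrier V \<Longrightarrow> lunit_inv V v = ptensor ground V 1 v"
    and lunit_inj: "inj_on (lunit V) (carrier (tensor ground V))"
proof -
  have bil: "bilinear_on ground V V (\<lambda>c v. c \<odot>\<^bsub>V\<^esub> v)"
    by (intro bilinear_onI linear_smult_map linear_id linear_onI)
      (simp_all add: vs_smult_add_left vs_smult_assoc)
  show lin: "linear_on (tensor ground V) V (lunit V)"
    and pure: "v \<in> carrier V \<Longrightarrow> lunit V (ptensor ground V c v) = c \<odot>\<^bsub>V\<^esub> v" for c v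
    unfolding lunit_def by (simp_all add: tensor_lift_linear[OF _ _ _ bil] tensor_lift_pure[OF _ _ _ bil])
  have g: "linear_on V (tensor ground V) (ptensor ground V 1)"
    by (rule ptensor_linear) simp_all
  have gf: "ptensor ground V 1 (lunit V x) = x" if "x \<in> carrier (tensor ground V)" for x
  proof (rule tensor_ext[OF _ _ linear_compose[OF lin g] linear_id _ that])
    fix c v assume [simp]: "v \<in> carrier V"
    have "ptensor ground V 1 (c \<odot>\<^bsub>V\<^esub> v) = ptensor ground V c v"
      using linear_smult[OF ptensor_linear(1)[of ground V 1], of v c]
        linear_smult[OF ptensor_linear(2)[of ground V v], of 1 c] by simp
    then show "ptensor ground V 1 (lunit V (ptensor ground V c v)) = ptensor ground V c v"
      by (simp add: pure)
  qed simp_all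
  then show "inj_on (lunit V) (carrier (tensor ground V))" by (metis inj_on_inverseI)
  show "lunit_inv V v = ptensor ground V 1 v" if "v \<in> carrier V"
    by (rule linear_inv_into[OF lin gf g]) (simp_all add: pure that)
qed

lemma runit:
  assumes [simp]: "vspace V"
  shows runit_linear: "linear_on (tensor V ground) V (runit V)"
    and runit_pure: "v \<in> carrier V \<Longrightarrow> runit V (ptensor V ground v c) = c \<odot>\<^bsub>V\<^esub> v"
    and runit_inv: "v \<in> carrier V \<Longrightarrow> runit_inv V v = ptensor V ground v 1"
proof -
  have bil: "bilinear_on V ground V (\<lambda>v c. c \<odot>\<^bsub>V\<^esub> v)"
    by (intro bilinear_onI linear_smult_map linear_id linear_onI)
      (simp_all add: vs_smult_add_left vs_smult_assoc)
  show lin: "linear_on (tensor V ground) V (runit V)"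
    and pure: "v \<in> carrier V \<Longrightarrow> runit V (ptensor V ground v c) = c \<odot>\<^bsub>V\<^esub> v" for c v
    unfolding runit_def by (simp_all add: tensor_lift_linear[OF _ _ _ bil] tensor_lift_pure[OF _ _ _ bil])
  have g: "linear_on V (tensor V ground) (\<lambda>v. ptensor V ground v 1)"
    by (rule ptensor_linear) simp_all
  have gf: "ptensor V ground (runit V x) 1 = x" if "x \<in> carrier (tensor V ground)" for x
  proof (rule tensor_ext[OF _ _ linear_compose[OF lin g] linear_id _ that])
    fix v c assume [simp]: "v \<in> carrier V"
    have "ptensor V ground (c \<odot>\<^bsub>V\<^esub> v) 1 = ptensor V ground v c"
      using linear_smult[OF ptensor_linear(1)[of V ground v], of 1 c]
        linear_smult[OF ptensor_linear(2)[of V ground 1], of v c] by simp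
    then show "ptensor V ground (runit V (ptensor V ground v c)) 1 = ptensor V ground v c"
      by (simp add: pure)
  qed simp_all
  show "runit_inv V v = ptensor V ground v 1" if "v \<in> carrier V"
    by (rule linear_inv_into[OF lin gf g]) (simp_all add: pure that)
qed

text \<open>The exchange of the middle factors for four unrelated spaces, so that the same statement also
  provides its inverse.\<close>

lemma middle_swap_exists:
  assumes [simp]: "vspace A" "vspace B" "vspace C" "vspace D"
  shows "\<exists>f. linear_on (tensor (tensor A B) (tensor C D)) (tensor (tensor A C) (tensor B D)) f \<and>
    (\<forall>a\<in>carrier A. \<forall>b\<in>carrier B. \<forall>c\<in>carrier C. \<forall>d\<in>carrier D.
      f (ptensor (tensor A B) (tensor C D) (ptensor A B a b) (ptensor C D c d))
        = ptensor (tensor A C) (tensor B D) (ptensor A C a c) (ptensor B D b d))"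
  by (rule quadrilinear_lift) (simp_all add: linear_ptensor_left linear_ptensor_right linear_id)

lemma middle_swap:
  assumes [simp]: "vspace V" "vspace W"
  defines "X \<equiv> tensor (tensor V W) (tensor V W)" and "Y \<equiv> tensor (tensor V V) (tensor W W)"
  shows middle_swap_linear: "linear_on X Y (middle_swap V W)"
    and middle_swap_pure: "v \<in> carrier V \<Longrightarrow> w \<in> carrier W \<Longrightarrow> v' \<in> carrier V \<Longrightarrow> w' \<in> carrier W
      \<Longrightarrow> middle_swap V W (ptensor (tensor V W) (tensor V W) (ptensor V W v w) (ptensor V W v' w'))
          = ptensor (tensor V V) (tensor W W) (ptensor V V v v') (ptensor W W w w')"
    and middle_swap_inv_linear: "linear_on Y X (inv_into (carrier X) (middle_swap V W))"
    and middle_swap_inv: "y \<in> carrier Y \<Longrightarrow> middle_swap V W (inv_into (carrier X) (middle_swap V W) y) = y"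
proof -
  from someI_ex[OF middle_swap_exists[of V W V W], folded middle_swap_def]
  show lin: "linear_on X Y (middle_swap V W)"
    and pure: "v \<in> carrier V \<Longrightarrow> w \<in> carrier W \<Longrightarrow> v' \<in> carrier V \<Longrightarrow> w' \<in> carrier W
      \<Longrightarrow> middle_swap V W (ptensor (tensor V W) (tensor V W) (ptensor V W v w) (ptensor V W v' w'))
          = ptensor (tensor V V) (tensor W W) (ptensor V V v v') (ptensor W W w w')" for v w v' w'
    by (auto simp: X_def Y_def)
  obtain g where g: "linear_on Y X g"
    "\<And>v v' w w'. v \<in> carrier V \<Longrightarrow> v' \<in> carrier V \<Longrightarrow> w \<in> carrier W \<Longrightarrow> w' \<in> carrier W \<Longrightarrow>
      g (ptensor (tensor V V) (tensor W W) (ptensor V V v v') (ptensor W W w w'))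
        = ptensor (tensor V W) (tensor V W) (ptensor V W v w) (ptensor V W v' w')"
    using middle_swap_exists[of V V W W] by (auto simp: X_def Y_def)
  have gf: "g (middle_swap V W x) = x" if "x \<in> carrier X" for x
    unfolding X_def
    by (rule tensor_ext_both[OF _ _ _ _ linear_compose[OF lin g(1), unfolded X_def] linear_id _ that[unfolded X_def]])
      (simp_all add: pure g)
  have fg: "middle_swap V W (g y) = y" if "y \<in> carrier Y" for y
    by (rule tensor_ext_both[OF _ _ _ _ linear_compose[OF g(1) lin, unfolded Y_def] linear_id _ that[unfolded Y_def]])
      (simp_all add: pure g)
  note inv = linear_inv_into[OF lin gf g(1) fg]
  show "linear_on Y X (inv_into (carrier X) (middle_swap V W))" by (rule inv(1))
  show "middle_swap V W (inv_into (carrier X) (middle_swap V W) y) = y" if "y \<in> carrier Y"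
    using that by (simp add: inv(2) fg)
qed

section \<open>Duals and finite bases\<close>

lemma dual_simps:
  "\<zero>\<^bsub>dual V\<^esub> = (\<lambda>v\<in>carrier V. 0)"
  "f \<oplus>\<^bsub>dual V\<^esub> g = (\<lambda>v\<in>carrier V. f v + g v)"
  "c \<odot>\<^bsub>dual V\<^esub> f = (\<lambda>v\<in>carrier V. c * f v)"
  by (simp_all add: dual_def)

lemma dual_carrier: "f \<in> carrier (dual V) \<longleftrightarrow> f \<in> extensional (carrier V) \<and> linear_on V ground f"
  by (simp add: dual_def)

lemma dual_linear: "f \<in> carrier (dual V) \<Longrightarrow> linear_on V ground f"
  by (simp add: dual_carrier)

text \<open>Functionals in the dual space are normalised to be undefined outside the carrier.\<close>

lemma dual_restrict: "linear_on V ground f \<Longrightarrow> (\<lambda>v\<in>carrier V. f v) \<in> carrier (dual V)"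
  by (auto simp: dual_carrier intro: linear_on_cong)

lemma dual_ext:
  assumes "f \<in> carrier (dual V)" "g \<in> carrier (dual V)" "\<And>v. v \<in> carrier V \<Longrightarrow> f v = g v"
  shows "f = g"
  using assms by (auto simp: dual_carrier intro: extensionalityI)

lemma vs_dual [simp]:
  assumes [simp]: "vspace V"
  shows "vspace (dual V)"
proof (rule vsI)
  note [simp] = dual_simps
  fix f g assume fg: "f \<in> carrier (dual V)" "g \<in> carrier (dual V)"
  note lf = dual_linear[OF fg(1)] and lg = dual_linear[OF fg(2)]
  show "f \<oplus>\<^bsub>dual V\<^esub> g \<in> carrier (dual V)"
    using dual_restrict[OF linear_add_map[OF lf lg]] by simp
  show "c \<odot>\<^bsub>dual V\<^esub> f \<in> carrier (dual V)" for c
    using dual_restrict[OF linear_smult_map[OF lf]] by simp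
  show "1 \<odot>\<^bsub>dual V\<^esub> f = f" "f \<oplus>\<^bsub>dual V\<^esub> \<zero>\<^bsub>dual V\<^esub> = f"
    using fg by (auto simp: dual_carrier extensional_def restrict_def)
qed (use dual_restrict[OF linear_zero_map[of V ground]] in
    \<open>auto simp: dual_simps algebra_simps restrict_def fun_eq_iff\<close>)

lemma eval_linear: "vspace V \<Longrightarrow> v \<in> carrier V \<Longrightarrow> linear_on (dual V) ground (\<lambda>f. f v)"
  by (rule linear_onI) (simp_all add: dual_simps)

lemma dual_finsum_apply:
  assumes "vspace V" "v \<in> carrier V" "\<And>i. i \<in> I \<Longrightarrow> x i \<in> carrier (dual V)"
  shows "(\<Oplus>\<^bsub>dual V\<^esub> i\<in>I. x i) v = (\<Sum>i\<in>I. x i v)"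
  using linear_finsum[OF eval_linear[OF assms(1,2)] assms(3)] by simp

abbreviation is_basis :: "('k::field, 'v) module \<Rightarrow> 'v set \<Rightarrow> bool" where
  "is_basis V B \<equiv> finite B \<and> vectorspace.basis class_ring V B"

text \<open>The functional \<open>b\<^sup>*\<close> is the coordinate along \<open>b\<close>. Coordinates are linear because they are unique,
  and a functional is determined by its values on \<open>B\<close>, so the description of \<open>dual_vector\<close>
  picks out the coordinate.\<close>

lemma basis_dual:
  assumes V [simp]: "vspace V" and B: "is_basis V B"
  shows basis_finite: "finite B"
    and basis_carrier: "b \<in> B \<Longrightarrow> b \<in> carrier V"
    and dual_vector_carrier: "b \<in> B \<Longrightarrow> dual_vector V B b \<in> carrier (dual V)"
    and dual_vector_basis: "b \<in> B \<Longrightarrow> b' \<in> B \<Longrightarrow> dual_vector V B b b' = (if b' = b then 1 else 0)"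
    and basis_expand: "v \<in> carrier V \<Longrightarrow> v = (\<Oplus>\<^bsub>V\<^esub> b\<in>B. dual_vector V B b v \<odot>\<^bsub>V\<^esub> b)"
proof -
  interpret V: vectorspace class_ring V by (fact V)
  show fin [simp]: "finite B" using B by simp
  have sub: "B \<subseteq> carrier V" using B by (simp add: V.basis_def)
  then show mem [simp]: "b \<in> carrier V" if "b \<in> B" for b using that by blast
  let ?L = "\<lambda>a. \<Oplus>\<^bsub>V\<^esub> b\<in>B. a b \<odot>\<^bsub>V\<^esub> b"
  have uniq: "\<exists>!a. a \<in> B \<rightarrow>\<^sub>E UNIV \<and> ?L a = v" if "v \<in> carrier V" for v
    using V.basis_criterion[OF fin sub] B that by (simp add: V.lincomb_def)
  \<comment> \<open>\<open>co v\<close> is the coordinate vector of \<open>v\<close>, and \<open>coI\<close> the uniqueness of coordinates.\<close>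
  define co where "co v = (THE a. a \<in> B \<rightarrow>\<^sub>E UNIV \<and> ?L a = v)" for v
  have co: "co v \<in> B \<rightarrow>\<^sub>E UNIV" "?L (co v) = v" if "v \<in> carrier V" for v
    using theI'[OF uniq[OF that]] by (simp_all add: co_def)
  have coI: "co v b = a b" if "?L a = v" "b \<in> B" for a v b
  proof -
    have v: "v \<in> carrier V" using that(1) by (auto intro!: vs_finsum_closed)
    have "?L (restrict a B) = ?L a" by (intro vs_finsum_cong) simp_all
    then have "co v = restrict a B"
      unfolding co_def using that(1) by (intro the1_equality uniq v) simp
    then show ?thesis using that(2) by simp
  qed
  have co_linear: "linear_on V ground (\<lambda>v. co v b)" if "b \<in> B" for b
  proof (rule linear_onI)
    fix v w assume [simp]: "v \<in> carrier V" "w \<in> carrier V"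
    have "?L (\<lambda>b. co v b + co w b) = ?L (co v) \<oplus>\<^bsub>V\<^esub> ?L (co w)"
      by (subst vs_finsum_add[symmetric]) (simp_all add: vs_smult_add_left cong: vs_finsum_cong)
    then show "co (v \<oplus>\<^bsub>V\<^esub> w) b = co v b \<oplus>\<^bsub>ground\<^esub> co w b"
      using coI[OF _ that, of "\<lambda>b. co v b + co w b"] by (simp add: co)
    have "?L (\<lambda>b. c * co v b) = c \<odot>\<^bsub>V\<^esub> ?L (co v)" for c
      by (subst vs_finsum_smult) (simp_all add: vs_smult_assoc cong: vs_finsum_cong)
    then show "co (c \<odot>\<^bsub>V\<^esub> v) b = c \<odot>\<^bsub>ground\<^esub> co v b" for c
      using coI[OF _ that, of "\<lambda>b. c * co v b"] by (simp add: co)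
  qed simp_all
  define \<phi> where "\<phi> b = (\<lambda>v\<in>carrier V. co v b)" for b
  have \<phi>: "\<phi> b \<in> carrier (dual V)" if "b \<in> B" for b
    using dual_restrict[OF co_linear[OF that]] by (simp add: \<phi>_def)
  have \<phi>_basis: "\<phi> b b' = (if b' = b then 1 else 0)" if "b \<in> B" "b' \<in> B" for b b'
    using coI[of "\<lambda>b. if b = b' then 1 else 0" b' b] that
    by (simp add: \<phi>_def vs_finsum_delta)
  have "dual_vector V B b = \<phi> b" if b: "b \<in> B" for b
    unfolding dual_vector_def
  proof (rule the_equality)
    show "\<phi> b \<in> carrier (dual V) \<and> (\<forall>b'\<in>B. \<phi> b b' = (if b' = b then 1 else 0))"
      using b \<phi> \<phi>_basis by blast
    fix f assume f: "f \<in> carrier (dual V) \<and> (\<forall>b'\<in>B. f b' = (if b' = b then 1 else 0))"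
    show "f = \<phi> b"
    proof (rule dual_ext)
      fix v assume v: "v \<in> carrier V"
      have expand: "g v = (\<Sum>c\<in>B. co v c * g c)" if "g \<in> carrier (dual V)" for g
        using that co(2)[OF v] linear_finsum[OF dual_linear[OF that], of B "\<lambda>c. co v c \<odot>\<^bsub>V\<^esub> c"]
        by (simp add: linear_smult[OF dual_linear])
      have "f v = (\<Sum>c\<in>B. co v c * f c)" using f expand by blast
      also have "\<dots> = (\<Sum>c\<in>B. co v c * \<phi> b c)"
        using f b by (intro sum.cong) (simp_all add: \<phi>_basis)
      also have "\<dots> = \<phi> b v" using expand[OF \<phi>[OF b]] by simp
      finally show "f v = \<phi> b v" .
    qed (use f \<phi> b in auto)
  qed
  then show "b \<in> B \<Longrightarrow> dual_vector V B b \<in> carrier (dual V)"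
    and "b \<in> B \<Longrightarrow> b' \<in> B \<Longrightarrow> dual_vector V B b b' = (if b' = b then 1 else 0)"
    and "v \<in> carrier V \<Longrightarrow> v = (\<Oplus>\<^bsub>V\<^esub> b\<in>B. dual_vector V B b v \<odot>\<^bsub>V\<^esub> b)" for b b' v
    using \<phi> \<phi>_basis co(2)[of v] by (simp_all add: \<phi>_def cong: vs_finsum_cong)
qed

text \<open>Apply \<open>f\<close> to the expansion of a vector in the basis.\<close>

lemma dual_expand:
  assumes [simp]: "vspace V" and B: "is_basis V B" and f: "f \<in> carrier (dual V)"
  shows "f = (\<Oplus>\<^bsub>dual V\<^esub> b\<in>B. f b \<odot>\<^bsub>dual V\<^esub> dual_vector V B b)"
proof (rule dual_ext[OF f])
  note [simp] = basis_carrier[OF _ B] dual_vector_carrier[OF _ B]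
  have mem: "f b \<odot>\<^bsub>dual V\<^esub> dual_vector V B b \<in> carrier (dual V)" if "b \<in> B" for b
    using that by simp
  then show "(\<Oplus>\<^bsub>dual V\<^esub> b\<in>B. f b \<odot>\<^bsub>dual V\<^esub> dual_vector V B b) \<in> carrier (dual V)"
    by simp
  fix v assume v [simp]: "v \<in> carrier V"
  have "f v = f (\<Oplus>\<^bsub>V\<^esub> b\<in>B. dual_vector V B b v \<odot>\<^bsub>V\<^esub> b)"
    using basis_expand[OF _ B v] by simp
  also have "\<dots> = (\<Sum>b\<in>B. f b * dual_vector V B b v)"
    by (subst linear_finsum[OF dual_linear[OF f]])
      (simp_all add: linear_smult[OF dual_linear[OF f]] mult.commute)
  finally show "f v = (\<Oplus>\<^bsub>dual V\<^esub> b\<in>B. f b \<odot>\<^bsub>dual V\<^esub> dual_vector V B b) v"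
    using dual_finsum_apply[where I = B and x = "\<lambda>b. f b \<odot>\<^bsub>dual V\<^esub> dual_vector V B b", OF _ v mem]
    by (simp add: dual_simps)
qed

lemma fd_vs_vspace: "fd_vs V \<Longrightarrow> vspace V"
  by (simp add: fd_vs_def)

lemma fd_vs_basis: "fd_vs V \<Longrightarrow> \<exists>B. is_basis V B"
  by (simp add: fd_vs_def vectorspace.finite_basis_exists)

lemma submodule_finsum:
  assumes "vspace V" "LinearCombinations.submodule class_ring N V" "\<And>i. i \<in> I \<Longrightarrow> x i \<in> N"
  shows "(\<Oplus>\<^bsub>V\<^esub> i\<in>I. x i) \<in> N"
  using assms(3)
proof (induction I rule: infinite_finite_induct)
  case (infinite I)
  then show ?case
    using submodule_mem(2)[OF assms(1,2)] assms(1)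
    by (simp add: vs_abelian_monoid abelian_monoid.finsum_infinite)
qed (use assms(1) submodule_mem[OF assms(1,2)] in \<open>auto simp: vs_finsum_insert\<close>)

text \<open>Spanning is expressed through subspaces, which avoids explicit coefficients.\<close>

lemma fd_vsI:
  assumes V: "vspace V" and S: "finite S" "S \<subseteq> carrier V"
    and span: "\<And>N. LinearCombinations.submodule class_ring N V \<Longrightarrow> S \<subseteq> N \<Longrightarrow> carrier V \<subseteq> N"
  shows "fd_vs V"
proof -
  interpret vectorspace class_ring V by (fact V)
  have "carrier V \<subseteq> span S"
    by (intro span span_is_submodule in_own_span S)
  then have "span S = carrier V"
    using span_is_subset2[OF S(2)] by blast
  then show ?thesis
    using S V unfolding fd_vs_def fin_dim_def by blast
qed

lemma fd_ground: "fd_vs ground"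
proof (rule fd_vsI)
  fix N :: "'a set" assume N: "LinearCombinations.submodule class_ring N ground" "{1} \<subseteq> N"
  have "c \<in> N" for c
    using submodule_mem(4)[OF vs_ground N(1), of 1 c] N(2) by simp
  then show "carrier ground \<subseteq> N" by blast
qed (simp_all)

lemma fd_dual:
  assumes "fd_vs V"
  shows "fd_vs (dual V)"
proof -
  have [simp]: "vspace V" using assms by (rule fd_vs_vspace)
  obtain B where B: "is_basis V B" using fd_vs_basis[OF assms] by blast
  show ?thesis
  proof (rule fd_vsI)
    fix N assume N: "LinearCombinations.submodule class_ring N (dual V)" "dual_vector V B ` B \<subseteq> N"
    show "carrier (dual V) \<subseteq> N"
    proof
      fix f assume f: "f \<in> carrier (dual V)"
      have "(\<Oplus>\<^bsub>dual V\<^esub> b\<in>B. f b \<odot>\<^bsub>dual V\<^esub> dual_vector V B b) \<in> N"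
        by (intro submodule_finsum submodule_mem(4)[OF _ N(1)] vs_dual N(1)) (use N(2) in auto)
      then show "f \<in> N" using dual_expand[OF _ B f] by simp
    qed
  qed (use B dual_vector_carrier[OF _ B] in auto)
qed

lemma fd_tensor:
  assumes "fd_vs V" "fd_vs W"
  shows "fd_vs (tensor V W)"
proof -
  have [simp]: "vspace V" "vspace W" using assms by (auto intro: fd_vs_vspace)
  obtain B C where B: "is_basis V B" and C: "is_basis W C" using fd_vs_basis[OF assms(1)] fd_vs_basis[OF assms(2)] by blast
  note [simp] = basis_carrier[OF _ B] basis_carrier[OF _ C]
  show ?thesis
  proof (rule fd_vsI)
    fix N assume N: "LinearCombinations.submodule class_ring N (tensor V W)"
      "(\<lambda>p. ptensor V W (fst p) (snd p)) ` (B \<times> C) \<subseteq> N"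
    note sub = submodule_mem[OF vs_tensor N(1)]
    show "carrier (tensor V W) \<subseteq> N"
    proof
      fix t assume "t \<in> carrier (tensor V W)"
      with \<open>vspace V\<close> \<open>vspace W\<close> show "t \<in> N"
      proof (induction t rule: tensor_elem_induct)
        case (pure v w)
        have "ptensor V W v w = ptensor V W (\<Oplus>\<^bsub>V\<^esub> b\<in>B. dual_vector V B b v \<odot>\<^bsub>V\<^esub> b)
            (\<Oplus>\<^bsub>W\<^esub> c\<in>C. dual_vector W C c w \<odot>\<^bsub>W\<^esub> c)"
          using basis_expand[OF _ B pure(1)] basis_expand[OF _ C pure(2)] by simp
        also have "\<dots> = (\<Oplus>\<^bsub>tensor V W\<^esub> p\<in>B \<times> C. ptensor V W
            (dual_vector V B (fst p) v \<odot>\<^bsub>V\<^esub> fst p) (dual_vector W C (snd p) w \<odot>\<^bsub>W\<^esub> snd p))"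
          by (rule ptensor_finsum) (use B C in simp_all)
        also have "\<dots> \<in> N"
          by (intro submodule_finsum N(1) vs_tensor)
            (use N(2) in \<open>auto simp: image_subset_iff ptensor_smult intro!: sub(4)\<close>)
        finally show ?case .
      next
        case (add s t)
        then show ?case using sub(3) by simp
      qed
    qed
  qed (use B C in auto)
qed

section \<open>The pairing of tensor squares and the transpose\<close>

text \<open>The pairing is defined by its values on pure tensors; it exists because \<open>f v * g w\<close> is linear
  in each of its four arguments.\<close>

lemma pairing2:
  assumes [simp]: "vspace V"
  defines "D \<equiv> dual V"
  shows pairing2_bilinear: "bilinear_on (tensor D D) (tensor V V) ground (pairing2 V)"
    and pairing2_pure: "f \<in> carrier D \<Longrightarrow> g \<in> carrier D \<Longrightarrow> v \<in> carrier V \<Longrightarrow> w \<in> carrier V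
      \<Longrightarrow> pairing2 V (ptensor D D f g) (ptensor V V v w) = f v * g w"
proof -
  have [simp]: "vspace D" by (simp add: D_def)
  have "\<exists>F. linear_on (tensor (tensor D D) (tensor V V)) ground F \<and>
    (\<forall>f\<in>carrier D. \<forall>g\<in>carrier D. \<forall>v\<in>carrier V. \<forall>w\<in>carrier V.
      F (ptensor (tensor D D) (tensor V V) (ptensor D D f g) (ptensor V V v w)) = f v * g w)"
    by (rule quadrilinear_lift)
      (simp_all add: D_def linear_ground_scale eval_linear dual_linear)
  then obtain F where F: "linear_on (tensor (tensor D D) (tensor V V)) ground F"
    "\<And>f g v w. f \<in> carrier D \<Longrightarrow> g \<in> carrier D \<Longrightarrow> v \<in> carrier V \<Longrightarrow> w \<in> carrier V
      \<Longrightarrow> F (ptensor (tensor D D) (tensor V V) (ptensor D D f g) (ptensor V V v w)) = f v * g w"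
    by blast
  have "bilinear_on (tensor D D) (tensor V V) ground (\<lambda>\<xi> t. F (ptensor (tensor D D) (tensor V V) \<xi> t))"
    by (intro bilinear_onI linear_compose[OF _ F(1)] linear_ptensor_left linear_ptensor_right linear_id)
      simp_all
  then have "\<exists>B. bilinear_on (tensor D D) (tensor V V) ground B \<and>
     (\<forall>f\<in>carrier D. \<forall>g\<in>carrier D. \<forall>v\<in>carrier V. \<forall>w\<in>carrier V.
        B (ptensor D D f g) (ptensor V V v w) = f v * g w)"
    using F(2) by blast
  from someI_ex[OF this[unfolded D_def], folded pairing2_def]
  show "bilinear_on (tensor D D) (tensor V V) ground (pairing2 V)"
    and "f \<in> carrier D \<Longrightarrow> g \<in> carrier D \<Longrightarrow> v \<in> carrier V \<Longrightarrow> w \<in> carrier V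
      \<Longrightarrow> pairing2 V (ptensor D D f g) (ptensor V V v w) = f v * g w"
    by (auto simp: D_def)
qed

lemmas pairing2_linear_right = bilinear_onD(1)[OF pairing2_bilinear]
lemmas pairing2_linear_left = bilinear_onD(2)[OF pairing2_bilinear]

text \<open>Pairs of basis vectors index the product basis of the tensor square; \<open>dual_basis2\<close> is the dual
  basis for the pairing of tensor squares.\<close>

definition basis2 :: "('k::field, 'v) module \<Rightarrow> 'v \<times> 'v \<Rightarrow> ('v \<times> 'v \<Rightarrow>\<^sub>0 'k) set" where
  "basis2 V p = ptensor V V (fst p) (snd p)"

definition dual_basis2 ::
  "('k::field, 'v) module \<Rightarrow> 'v set \<Rightarrow> 'v \<times> 'v \<Rightarrow> (('v \<Rightarrow> 'k) \<times> ('v \<Rightarrow> 'k) \<Rightarrow>\<^sub>0 'k) set" where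
  "dual_basis2 V B p
    = ptensor (dual V) (dual V) (dual_vector V B (fst p)) (dual_vector V B (snd p))"

context
  fixes V :: "('k::field, 'v) module" and B
  assumes V [simp]: "vspace V" and B: "is_basis V B"
begin

private abbreviation (input) "D \<equiv> dual V"

lemma basis_mem:
  "finite B" "b \<in> B \<Longrightarrow> b \<in> carrier V" "b \<in> B \<Longrightarrow> dual_vector V B b \<in> carrier D"
  using basis_dual[OF V B] by auto

lemma basis2_mem:
  "p \<in> B \<times> B \<Longrightarrow> basis2 V p \<in> carrier (tensor V V)"
  "p \<in> B \<times> B \<Longrightarrow> dual_basis2 V B p \<in> carrier (tensor D D)"
  by (auto simp: basis2_def dual_basis2_def basis_mem)

text \<open>Both sides are linear in \<open>t\<close>, and for \<open>t = v \<otimes> w\<close> this is the product of the basis expansions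
  of \<open>v\<close> and \<open>w\<close>.\<close>

lemma tensor_square_expand:
  assumes t: "t \<in> carrier (tensor V V)"
  shows "t = (\<Oplus>\<^bsub>tensor V V\<^esub> p\<in>B \<times> B. pairing2 V (dual_basis2 V B p) t \<odot>\<^bsub>tensor V V\<^esub> basis2 V p)"
proof (rule tensor_ext[OF V V linear_id _ _ t])
  note [simp] = basis_mem basis2_mem
  show "linear_on (tensor V V) (tensor V V)
      (\<lambda>t. \<Oplus>\<^bsub>tensor V V\<^esub> p\<in>B \<times> B. pairing2 V (dual_basis2 V B p) t \<odot>\<^bsub>tensor V V\<^esub> basis2 V p)"
    by (intro linear_finsum_map linear_scale_vector pairing2_linear_right V) simp_all
  fix v w assume v: "v \<in> carrier V" and w: "w \<in> carrier V"
  have "ptensor V V v w = ptensor V V (\<Oplus>\<^bsub>V\<^esub> b\<in>B. dual_vector V B b v \<odot>\<^bsub>V\<^esub> b)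
      (\<Oplus>\<^bsub>V\<^esub> b\<in>B. dual_vector V B b w \<odot>\<^bsub>V\<^esub> b)"
    using basis_expand[OF V B v] basis_expand[OF V B w] by simp
  also have "\<dots> = (\<Oplus>\<^bsub>tensor V V\<^esub> p\<in>B \<times> B.
      ptensor V V (dual_vector V B (fst p) v \<odot>\<^bsub>V\<^esub> fst p) (dual_vector V B (snd p) w \<odot>\<^bsub>V\<^esub> snd p))"
    by (rule ptensor_finsum) simp_all
  also have "\<dots> = (\<Oplus>\<^bsub>tensor V V\<^esub> p\<in>B \<times> B.
      pairing2 V (dual_basis2 V B p) (ptensor V V v w) \<odot>\<^bsub>tensor V V\<^esub> basis2 V p)"
    by (rule vs_finsum_cong)
      (auto simp: v w dual_basis2_def basis2_def pairing2_pure ptensor_smult_both)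
  finally show "ptensor V V v w = \<dots>" .
qed simp_all

lemma dual_tensor_square_expand:
  assumes \<xi>: "\<xi> \<in> carrier (tensor D D)"
  shows "\<xi> = (\<Oplus>\<^bsub>tensor D D\<^esub> p\<in>B \<times> B. pairing2 V \<xi> (basis2 V p) \<odot>\<^bsub>tensor D D\<^esub> dual_basis2 V B p)"
proof (rule tensor_ext[OF _ _ linear_id _ _ \<xi>])
  note [simp] = basis_mem basis2_mem
  show "linear_on (tensor D D) (tensor D D)
      (\<lambda>\<xi>. \<Oplus>\<^bsub>tensor D D\<^esub> p\<in>B \<times> B. pairing2 V \<xi> (basis2 V p) \<odot>\<^bsub>tensor D D\<^esub> dual_basis2 V B p)"
    by (intro linear_finsum_map linear_scale_vector pairing2_linear_left V) simp_all
  fix f g assume f: "f \<in> carrier D" and g: "g \<in> carrier D"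
  have "ptensor D D f g = ptensor D D (\<Oplus>\<^bsub>D\<^esub> b\<in>B. f b \<odot>\<^bsub>D\<^esub> dual_vector V B b)
      (\<Oplus>\<^bsub>D\<^esub> b\<in>B. g b \<odot>\<^bsub>D\<^esub> dual_vector V B b)"
    using dual_expand[OF V B f] dual_expand[OF V B g] by simp
  also have "\<dots> = (\<Oplus>\<^bsub>tensor D D\<^esub> p\<in>B \<times> B.
      ptensor D D (f (fst p) \<odot>\<^bsub>D\<^esub> dual_vector V B (fst p)) (g (snd p) \<odot>\<^bsub>D\<^esub> dual_vector V B (snd p)))"
    by (rule ptensor_finsum) simp_all
  also have "\<dots> = (\<Oplus>\<^bsub>tensor D D\<^esub> p\<in>B \<times> B.
      pairing2 V (ptensor D D f g) (basis2 V p) \<odot>\<^bsub>tensor D D\<^esub> dual_basis2 V B p)"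
    by (rule vs_finsum_cong)
      (auto simp: f g dual_basis2_def basis2_def pairing2_pure ptensor_smult_both)
  finally show "ptensor D D f g = \<dots>" .
qed simp_all

text \<open>The coefficients in \<open>dual_tensor_square_expand\<close> are values of the pairing.\<close>

lemma pairing2_nondegenerate:
  assumes "\<xi> \<in> carrier (tensor D D)" "\<eta> \<in> carrier (tensor D D)"
    and "\<And>t. t \<in> carrier (tensor V V) \<Longrightarrow> pairing2 V \<xi> t = pairing2 V \<eta> t"
  shows "\<xi> = \<eta>"
proof -
  note [simp] = basis_mem basis2_mem
  have "\<xi> = (\<Oplus>\<^bsub>tensor D D\<^esub> p\<in>B \<times> B. pairing2 V \<xi> (basis2 V p) \<odot>\<^bsub>tensor D D\<^esub> dual_basis2 V B p)"
    by (rule dual_tensor_square_expand) fact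
  also have "\<dots> = (\<Oplus>\<^bsub>tensor D D\<^esub> p\<in>B \<times> B. pairing2 V \<eta> (basis2 V p) \<odot>\<^bsub>tensor D D\<^esub> dual_basis2 V B p)"
    by (rule vs_finsum_cong) (simp_all add: assms(3))
  also have "\<dots> = \<eta>"
    by (rule dual_tensor_square_expand[symmetric]) fact
  finally show ?thesis .
qed

text \<open>The transpose is \<open>R\<^sup>* \<xi> = \<Sum>\<^sub>p \<langle>\<xi>, R e\<^sub>p\<rangle> e\<^sub>p\<^sup>*\<close>.\<close>

lemma transpose2:
  assumes R: "linear_on (tensor V V) (tensor V V) R"
  shows transpose2_linear: "linear_on (tensor D D) (tensor D D) (transpose2 V R)"
    and transpose2_pairing: "\<xi> \<in> carrier (tensor D D) \<Longrightarrow> t \<in> carrier (tensor V V)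
      \<Longrightarrow> pairing2 V (transpose2 V R \<xi>) t = pairing2 V \<xi> (R t)"
proof -
  note [simp] = basis_mem basis2_mem
  define Q where "Q \<xi> = (\<Oplus>\<^bsub>tensor D D\<^esub> p\<in>B \<times> B.
    pairing2 V \<xi> (R (basis2 V p)) \<odot>\<^bsub>tensor D D\<^esub> dual_basis2 V B p)" for \<xi>
  note R_mem = linear_closed[OF R]
  have "linear_on (tensor D D) (tensor D D) Q"
    unfolding Q_def
    by (intro linear_finsum_map linear_scale_vector pairing2_linear_left V) (simp_all add: R_mem)
  moreover have "pairing2 V (Q \<xi>) t = pairing2 V \<xi> (R t)"
    if \<xi>: "\<xi> \<in> carrier (tensor D D)" and t: "t \<in> carrier (tensor V V)" for \<xi> t
  proof -
    have "pairing2 V (Q \<xi>) t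
        = (\<Sum>p\<in>B \<times> B. pairing2 V \<xi> (R (basis2 V p)) * pairing2 V (dual_basis2 V B p) t)"
      unfolding Q_def using t
      by (subst linear_finsum[OF pairing2_linear_left[OF _ t]])
        (auto simp: linear_smult[OF pairing2_linear_left[OF _ t]] intro!: sum.cong)
    also have "\<dots> = pairing2 V \<xi> (R (\<Oplus>\<^bsub>tensor V V\<^esub> p\<in>B \<times> B.
        pairing2 V (dual_basis2 V B p) t \<odot>\<^bsub>tensor V V\<^esub> basis2 V p))"
      using linear_compose[OF R pairing2_linear_right[OF _ \<xi>]]
      by (subst linear_finsum[OF linear_compose[OF R pairing2_linear_right[OF _ \<xi>]]])
        (auto simp: linear_smult[OF linear_compose[OF R pairing2_linear_right[OF _ \<xi>]]] intro!: sum.cong)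
    finally show ?thesis using tensor_square_expand[OF t] by simp
  qed
  ultimately have "\<exists>Q. linear_on (tensor D D) (tensor D D) Q \<and>
     (\<forall>\<xi>\<in>carrier (tensor D D). \<forall>t\<in>carrier (tensor V V). pairing2 V (Q \<xi>) t = pairing2 V \<xi> (R t))"
    by blast
  from someI_ex[OF this, folded transpose2_def]
  show "linear_on (tensor D D) (tensor D D) (transpose2 V R)"
    and "\<xi> \<in> carrier (tensor D D) \<Longrightarrow> t \<in> carrier (tensor V V)
      \<Longrightarrow> pairing2 V (transpose2 V R \<xi>) t = pairing2 V \<xi> (R t)"
    by auto
qed

text \<open>The canonical element of \<open>V\<^sup>\<otimes>\<^sup>2 \<otimes> (V\<^sup>*)\<^sup>\<otimes>\<^sup>2\<close> cannot tell \<open>R\<close> on the left from its transpose on the right: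
  with \<open>r\<^sub>q\<^sub>p = \<langle>e\<^sub>q\<^sup>*, R e\<^sub>p\<rangle>\<close>, both sides are \<open>\<Sum>\<^sub>p\<^sub>q r\<^sub>q\<^sub>p e\<^sub>q \<otimes> e\<^sub>p\<^sup>*\<close>. This is why coevaluation is an arrow.\<close>

lemma transpose2_casimir:
  assumes R: "linear_on (tensor V V) (tensor V V) R"
  shows "(\<Oplus>\<^bsub>tensor (tensor V V) (tensor D D)\<^esub> p\<in>B \<times> B.
      ptensor (tensor V V) (tensor D D) (R (basis2 V p)) (dual_basis2 V B p))
    = (\<Oplus>\<^bsub>tensor (tensor V V) (tensor D D)\<^esub> p\<in>B \<times> B.
      ptensor (tensor V V) (tensor D D) (basis2 V p) (transpose2 V R (dual_basis2 V B p)))"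
proof -
  note [simp] = basis_mem basis2_mem
  let ?T = "tensor (tensor V V) (tensor D D)"
  let ?P = "ptensor (tensor V V) (tensor D D)"
  define r where "r q p = pairing2 V (dual_basis2 V B q) (R (basis2 V p))" for q p
  note R_mem [simp] = linear_closed[OF R] and T_mem [simp] = linear_closed[OF transpose2_linear[OF R]]
  have left: "?P (R (basis2 V p)) (dual_basis2 V B p)
      = (\<Oplus>\<^bsub>?T\<^esub> q\<in>B \<times> B. r q p \<odot>\<^bsub>?T\<^esub> ?P (basis2 V q) (dual_basis2 V B p))" if p: "p \<in> B \<times> B" for p
  proof -
    have "R (basis2 V p) = (\<Oplus>\<^bsub>tensor V V\<^esub> q\<in>B \<times> B. r q p \<odot>\<^bsub>tensor V V\<^esub> basis2 V q)"
      unfolding r_def by (rule tensor_square_expand) (simp add: p)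
    then have "?P (R (basis2 V p)) (dual_basis2 V B p)
        = ?P (\<Oplus>\<^bsub>tensor V V\<^esub> q\<in>B \<times> B. r q p \<odot>\<^bsub>tensor V V\<^esub> basis2 V q) (dual_basis2 V B p)"
      by (rule arg_cong[where f = "\<lambda>x. ?P x (dual_basis2 V B p)"])
    also have "\<dots>
        = (\<Oplus>\<^bsub>?T\<^esub> q\<in>B \<times> B. ?P (r q p \<odot>\<^bsub>tensor V V\<^esub> basis2 V q) (dual_basis2 V B p))"
      by (rule linear_finsum[OF ptensor_linear(2)]) (simp_all add: p)
    also have "\<dots> = (\<Oplus>\<^bsub>?T\<^esub> q\<in>B \<times> B. r q p \<odot>\<^bsub>?T\<^esub> ?P (basis2 V q) (dual_basis2 V B p))"
      by (rule vs_finsum_cong) (simp_all add: p ptensor_smult)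
    finally show ?thesis .
  qed
  have right: "(\<Oplus>\<^bsub>?T\<^esub> p\<in>B \<times> B. r q p \<odot>\<^bsub>?T\<^esub> ?P (basis2 V q) (dual_basis2 V B p))
      = ?P (basis2 V q) (transpose2 V R (dual_basis2 V B q))" if q: "q \<in> B \<times> B" for q
  proof -
    have "transpose2 V R (dual_basis2 V B q) = (\<Oplus>\<^bsub>tensor D D\<^esub> p\<in>B \<times> B.
        pairing2 V (transpose2 V R (dual_basis2 V B q)) (basis2 V p) \<odot>\<^bsub>tensor D D\<^esub> dual_basis2 V B p)"
      by (rule dual_tensor_square_expand) (simp add: q)
    also have "\<dots> = (\<Oplus>\<^bsub>tensor D D\<^esub> p\<in>B \<times> B. r q p \<odot>\<^bsub>tensor D D\<^esub> dual_basis2 V B p)"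
      by (rule vs_finsum_cong) (simp_all add: q r_def transpose2_pairing[OF R])
    finally have "?P (basis2 V q) (transpose2 V R (dual_basis2 V B q))
        = ?P (basis2 V q) (\<Oplus>\<^bsub>tensor D D\<^esub> p\<in>B \<times> B. r q p \<odot>\<^bsub>tensor D D\<^esub> dual_basis2 V B p)"
      by (rule arg_cong[where f = "?P (basis2 V q)"])
    also have "\<dots>
        = (\<Oplus>\<^bsub>?T\<^esub> p\<in>B \<times> B. ?P (basis2 V q) (r q p \<odot>\<^bsub>tensor D D\<^esub> dual_basis2 V B p))"
      by (rule linear_finsum[OF ptensor_linear(1)]) (simp_all add: q)
    also have "\<dots> = (\<Oplus>\<^bsub>?T\<^esub> p\<in>B \<times> B. r q p \<odot>\<^bsub>?T\<^esub> ?P (basis2 V q) (dual_basis2 V B p))"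
      by (rule vs_finsum_cong) (simp_all add: q ptensor_smult)
    finally show ?thesis by (rule sym)
  qed
  have "(\<Oplus>\<^bsub>?T\<^esub> p\<in>B \<times> B. ?P (R (basis2 V p)) (dual_basis2 V B p))
      = (\<Oplus>\<^bsub>?T\<^esub> p\<in>B \<times> B. \<Oplus>\<^bsub>?T\<^esub> q\<in>B \<times> B. r q p \<odot>\<^bsub>?T\<^esub> ?P (basis2 V q) (dual_basis2 V B p))"
    by (rule vs_finsum_cong) (simp_all add: left)
  also have "\<dots> = (\<Oplus>\<^bsub>?T\<^esub> q\<in>B \<times> B. \<Oplus>\<^bsub>?T\<^esub> p\<in>B \<times> B. r q p \<odot>\<^bsub>?T\<^esub> ?P (basis2 V q) (dual_basis2 V B p))"
    by (rule vs_finsum_swap) simp_all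
  also have "\<dots> = (\<Oplus>\<^bsub>?T\<^esub> q\<in>B \<times> B. ?P (basis2 V q) (transpose2 V R (dual_basis2 V B q)))"
    by (rule vs_finsum_cong) (simp_all add: right)
  finally show ?thesis .
qed

end

section \<open>Evaluation and coevaluation\<close>

lemma ev:
  assumes V [simp]: "vspace V"
  shows ev_linear: "linear_on (tensor (dual V) V) ground (ev V)"
    and ev_pure: "f \<in> carrier (dual V) \<Longrightarrow> v \<in> carrier V \<Longrightarrow> ev V (ptensor (dual V) V f v) = f v"
proof -
  have "bilinear_on (dual V) V ground (\<lambda>f v. f v)"
    by (intro bilinear_onI dual_linear eval_linear V)
  from tensor_lift[OF vs_dual[OF V] V vs_ground this]
  show "linear_on (tensor (dual V) V) ground (ev V)"
    and "f \<in> carrier (dual V) \<Longrightarrow> v \<in> carrier V \<Longrightarrow> ev V (ptensor (dual V) V f v) = f v"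
    by (auto simp: ev_def)
qed

definition casimir :: "('k::field, 'v) module \<Rightarrow> 'v set \<Rightarrow> ('v \<times> ('v \<Rightarrow> 'k) \<Rightarrow>\<^sub>0 'k) set" where
  "casimir V B = (\<Oplus>\<^bsub>tensor V (dual V)\<^esub> b\<in>B. ptensor V (dual V) b (dual_vector V B b))"

text \<open>Any statement proved for the canonical element of every finite basis applies to the basis that
  is chosen inside \<open>coev\<close>.\<close>

lemma coev_eq:
  assumes "fd_vs V"
  obtains B where "is_basis V B" "coev V = (\<lambda>c. c \<odot>\<^bsub>tensor V (dual V)\<^esub> casimir V B)"
  using someI_ex[OF fd_vs_basis[OF assms]] by (auto simp: coev_def Let_def casimir_def)

lemma casimir_mem: "vspace V \<Longrightarrow> is_basis V B \<Longrightarrow> casimir V B \<in> carrier (tensor V (dual V))"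
  unfolding casimir_def by (intro vs_finsum_closed) (simp_all add: basis_mem[of V B])

lemma coev_linear:
  assumes "fd_vs V"
  shows "linear_on ground (tensor V (dual V)) (coev V)"
proof -
  have V: "vspace V" using assms by (rule fd_vs_vspace)
  obtain B where "is_basis V B" "coev V = (\<lambda>c. c \<odot>\<^bsub>tensor V (dual V)\<^esub> casimir V B)"
    using assms by (rule coev_eq)
  then show ?thesis using V by (simp add: linear_scale_point casimir_mem)
qed

text \<open>The composite after inserting \<open>\<Omega>\<close> is a linear function \<open>h\<close> of \<open>\<Omega>\<close> with \<open>h (x \<otimes> f) = f(v) x\<close>; summing
  over the basis gives the expansion of \<open>v\<close>.\<close>

lemma zigzag_left:
  assumes fd: "fd_vs V" and v: "v \<in> carrier V"
  shows "(runit V \<circ> tensor_map V (tensor (dual V) V) V ground (\<lambda>x. x) (ev V) \<circ> assoc V (dual V) V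
    \<circ> tensor_map ground V (tensor V (dual V)) V (coev V) (\<lambda>x. x) \<circ> lunit_inv V) v = v"
proof -
  let ?D = "dual V"
  note [simp] = fd_vs_vspace[OF fd] v
  obtain B where B: "is_basis V B" and coev: "coev V = (\<lambda>c. c \<odot>\<^bsub>tensor V ?D\<^esub> casimir V B)"
    using fd by (rule coev_eq)
  note [simp] = basis_mem[OF _ B] casimir_mem[OF _ B]
  define h where "h x = runit V (tensor_map V (tensor ?D V) V ground (\<lambda>x. x) (ev V)
    (assoc V ?D V (ptensor (tensor V ?D) V x v)))" for x
  have h: "linear_on (tensor V ?D) V h"
    unfolding h_def
    by (intro linear_compose[OF _ runit_linear] linear_compose[OF _ tensor_map_linear]
        linear_compose[OF _ assoc_linear] linear_ptensor_left linear_id ev_linear) simp_all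
  have h_pure: "h (ptensor V ?D x f) = f v \<odot>\<^bsub>V\<^esub> x" if "x \<in> carrier V" "f \<in> carrier ?D" for x f
    using that
    by (simp add: h_def assoc_pure tensor_map_pure[OF linear_id ev_linear] ev_pure runit_pure)
  have "h (casimir V B) = (\<Oplus>\<^bsub>V\<^esub> b\<in>B. h (ptensor V ?D b (dual_vector V B b)))"
    unfolding casimir_def by (rule linear_finsum[OF h]) simp
  also have "\<dots> = (\<Oplus>\<^bsub>V\<^esub> b\<in>B. dual_vector V B b v \<odot>\<^bsub>V\<^esub> b)"
    by (rule vs_finsum_cong) (simp_all add: h_pure)
  also have "\<dots> = v" using basis_expand[OF _ B v] by simp
  finally show ?thesis
    using coev_linear[OF fd]
    by (simp add: lunit_inv tensor_map_pure[OF _ linear_id] h_def) (simp add: coev)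
qed

text \<open>As in \<open>zigzag_left\<close>, the composite is a linear function \<open>h\<close> of \<open>\<Omega>\<close>, now with
  \<open>h (x \<otimes> f) = g(l x) f\<close>, so it yields the expansion of \<open>g \<circ> l\<close> in the dual basis.\<close>

lemma dual_arrow_transpose:
  assumes fdV: "fd_vs V" and W [simp]: "vspace W" and l: "linear_on V W l" and g: "g \<in> carrier (dual W)"
  shows "dual_arrow V (dual V) (coev V) W (dual W) (ev W) l g = transpose_map V l g"
proof -
  let ?D = "dual V" and ?E = "dual W"
  note [simp] = fd_vs_vspace[OF fdV] g linear_closed[OF l]
  obtain B where B: "is_basis V B" and coev: "coev V = (\<lambda>c. c \<odot>\<^bsub>tensor V ?D\<^esub> casimir V B)"
    using fdV by (rule coev_eq)
  note [simp] = basis_mem[OF _ B] casimir_mem[OF _ B]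
  have gl: "transpose_map V l g \<in> carrier ?D"
    using dual_restrict[OF linear_compose[OF l dual_linear[OF g]]] by (simp add: transpose_map_def)
  have El: "linear_on (tensor ?E V) (tensor ?E W) (tensor_map ?E V ?E W (\<lambda>x. x) l)"
    by (intro tensor_map_linear linear_id l) simp
  define h where "h x = lunit ?D (tensor_map (tensor ?E W) ?D ground ?D (ev W) (\<lambda>x. x)
    (tensor_map (tensor ?E V) ?D (tensor ?E W) ?D (tensor_map ?E V ?E W (\<lambda>x. x) l) (\<lambda>x. x)
      (assoc_inv ?E V ?D (ptensor ?E (tensor V ?D) g x))))" for x
  have h: "linear_on (tensor V ?D) ?D h"
    unfolding h_def
    by (intro linear_compose[OF _ lunit_linear] linear_compose[OF _ tensor_map_linear[OF ev_linear linear_id]]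
        linear_compose[OF _ tensor_map_linear[OF El linear_id]]
        linear_compose[OF _ assoc_inv_linear] linear_ptensor_right linear_id) simp_all
  have h_pure: "h (ptensor V ?D x f) = g (l x) \<odot>\<^bsub>?D\<^esub> f" if "x \<in> carrier V" "f \<in> carrier ?D" for x f
    using that
    by (simp add: h_def assoc_inv_pure tensor_map_pure[OF El linear_id] tensor_map_pure[OF linear_id l]
        tensor_map_pure[OF ev_linear linear_id] ev_pure lunit_pure)
  have "h (casimir V B) = (\<Oplus>\<^bsub>?D\<^esub> b\<in>B. h (ptensor V ?D b (dual_vector V B b)))"
    unfolding casimir_def by (rule linear_finsum[OF h]) simp
  also have "\<dots> = (\<Oplus>\<^bsub>?D\<^esub> b\<in>B. transpose_map V l g b \<odot>\<^bsub>?D\<^esub> dual_vector V B b)"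
    by (rule vs_finsum_cong) (simp_all add: h_pure transpose_map_def)
  also have "\<dots> = transpose_map V l g" using dual_expand[OF _ B gl] by simp
  finally show ?thesis
    using coev_linear[OF fdV]
    by (simp add: dual_arrow_def runit_inv tensor_map_pure[OF linear_id] h_def) (simp add: coev)
qed

lemma transpose_map_id: "f \<in> carrier (dual V) \<Longrightarrow> transpose_map V (\<lambda>v. v) f = f"
  by (simp add: transpose_map_def dual_carrier extensional_restrict)

text \<open>The case \<open>l = id\<close> of \<open>dual_arrow_transpose\<close>, whose extra factor \<open>(id \<otimes> id) \<otimes> id\<close> is the identity.\<close>

lemma zigzag_right:
  assumes fd: "fd_vs V" and f: "f \<in> carrier (dual V)"
  shows "(lunit (dual V) \<circ> tensor_map (tensor (dual V) V) (dual V) ground (dual V) (ev V) (\<lambda>x. x)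
    \<circ> assoc_inv (dual V) V (dual V)
    \<circ> tensor_map (dual V) ground (dual V) (tensor V (dual V)) (\<lambda>x. x) (coev V) \<circ> runit_inv (dual V)) f = f"
proof -
  let ?D = "dual V"
  note [simp] = fd_vs_vspace[OF fd]
  note c = coev_linear[OF fd]
  define x where "x = assoc_inv ?D V ?D (tensor_map ?D ground ?D (tensor V ?D) (\<lambda>x. x) (coev V) (runit_inv ?D f))"
  have x: "x \<in> carrier (tensor (tensor ?D V) ?D)"
    using f linear_closed[OF c] unfolding x_def
    by (intro linear_closed[OF assoc_inv_linear] linear_closed[OF tensor_map_linear[OF linear_id c]])
      (simp_all add: runit_inv)
  \<comment> \<open>Functoriality on identities, once for the inner and once for the outer tensor product.\<close>
  have "tensor_map ?D V ?D V (\<lambda>x. x) (\<lambda>x. x) t = t" if "t \<in> carrier (tensor ?D V)" for t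
    by (rule tensor_ext[OF _ _ tensor_map_linear linear_id _ that])
      (simp_all add: linear_id tensor_map_pure)
  then have "tensor_map (tensor ?D V) ?D (tensor ?D V) ?D (tensor_map ?D V ?D V (\<lambda>x. x) (\<lambda>x. x)) (\<lambda>x. x) x = x"
    by (intro tensor_ext[OF _ _ tensor_map_linear linear_id _ x])
      (simp_all add: linear_id tensor_map_linear tensor_map_pure)
  then show ?thesis
    using dual_arrow_transpose[OF fd _ linear_id f] f
    by (simp add: dual_arrow_def transpose_map_id flip: x_def)
qed

section \<open>Operators on tensor products\<close>

text \<open>The operator \<open>R \<otimes> id + id \<otimes> S\<close>, to which \<open>R \<boxtimes> S\<close> is conjugate by \<open>middle_swap\<close>.\<close>

definition leibniz ::
  "('k::field, 'v) module \<Rightarrow> ('v \<Rightarrow> 'v) \<Rightarrow> ('k, 'w) module \<Rightarrow> ('w \<Rightarrow> 'w)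
    \<Rightarrow> ('v \<times> 'w \<Rightarrow>\<^sub>0 'k) set \<Rightarrow> ('v \<times> 'w \<Rightarrow>\<^sub>0 'k) set" where
  "leibniz X R Y S s
    = tensor_map X Y X Y R (\<lambda>y. y) s \<oplus>\<^bsub>tensor X Y\<^esub> tensor_map X Y X Y (\<lambda>x. x) S s"

lemma leibniz:
  assumes R: "linear_on X X R" and S: "linear_on Y Y S"
  shows leibniz_linear: "linear_on (tensor X Y) (tensor X Y) (leibniz X R Y S)"
    and leibniz_pure: "x \<in> carrier X \<Longrightarrow> y \<in> carrier Y
      \<Longrightarrow> leibniz X R Y S (ptensor X Y x y) = ptensor X Y (R x) y \<oplus>\<^bsub>tensor X Y\<^esub> ptensor X Y x (S y)"
  unfolding leibniz_def using linear_dom[OF R] linear_dom[OF S]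
  by (auto intro!: linear_add_map tensor_map_linear R S linear_id
      simp: tensor_map_pure[OF R linear_id] tensor_map_pure[OF linear_id S])

lemma eqa_tensor_eq:
  "eqa_tensor (V, R) (W, S) = (tensor V W,
    \<lambda>t. inv_into (carrier (tensor (tensor V W) (tensor V W))) (middle_swap V W)
      (leibniz (tensor V V) R (tensor W W) S (middle_swap V W t)))"
  by (simp add: leibniz_def)

lemma eqa_obj_vspace:
  assumes "eqa_obj (V, R)"
  shows "fd_vs V" "vspace V" "linear_on (tensor V V) (tensor V V) R"
  using assms by (auto simp: fd_vs_vspace)

lemma eqa_obj_tensor:
  assumes X: "eqa_obj (V, R)" and Y: "eqa_obj (W, S)"
  shows "eqa_obj (eqa_tensor (V, R) (W, S))"
  unfolding eqa_tensor_eq eqa_obj.simps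
  by (intro conjI fd_tensor linear_compose[OF _ middle_swap_inv_linear]
      linear_compose[OF _ leibniz_linear] middle_swap_linear eqa_obj_vspace[OF X] eqa_obj_vspace[OF Y])

lemma eqa_obj_unit: "eqa_obj eqa_unit"
  by (simp add: eqa_unit_def fd_ground linear_zero_map)

lemma eqa_obj_dagger:
  assumes X: "eqa_obj (V, R)"
  shows "eqa_obj (eqa_dagger (V, R))"
proof -
  note V = eqa_obj_vspace[OF X]
  obtain B where B: "is_basis V B" using fd_vs_basis[OF V(1)] by blast
  show ?thesis
    using V by (simp add: fd_dual linear_neg_map transpose2_linear[OF V(2) B V(3)])
qed

text \<open>With \<open>\<mu>\<close> the pairing on \<open>(V\<^sup>*)\<^sup>\<otimes>\<^sup>2 \<otimes> V\<^sup>\<otimes>\<^sup>2\<close>, the map \<open>ev \<otimes> ev\<close> is \<open>\<mu>\<close> after the middle exchange (up to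
  \<open>k \<otimes> k = k\<close>), and \<open>\<mu>\<close> kills the image of the Leibniz operator of \<open>- R\<^sup>*\<close> and \<open>R\<close> by the
  definition of the transpose.\<close>

lemma ev_arrow:
  assumes X: "eqa_obj (V, R)"
  shows "eqa_arrow (eqa_tensor (eqa_dagger (V, R)) (V, R)) eqa_unit (ev V)"
proof -
  let ?D = "dual V"
  let ?DD = "tensor ?D ?D" and ?VV = "tensor V V" and ?DV = "tensor ?D V"
  note fd = eqa_obj_vspace(1)[OF X] and V [simp] = eqa_obj_vspace(2)[OF X] and R = eqa_obj_vspace(3)[OF X]
  obtain B where B: "is_basis V B" using fd_vs_basis[OF fd] by blast
  note T = transpose2_linear[OF V B R] and T_pairing = transpose2_pairing[OF V B R]
  let ?N = "\<lambda>\<xi>. \<ominus>\<^bsub>?DD\<^esub> transpose2 V R \<xi>"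
  have N: "linear_on ?DD ?DD ?N" by (rule linear_neg_map[OF T])
  let ?L = "leibniz ?DD ?N ?VV R"
  note L = leibniz_linear[OF N R]
  define \<mu> where "\<mu> = tensor_lift ?DD ?VV ground (pairing2 V)"
  have \<mu>: "linear_on (tensor ?DD ?VV) ground \<mu>"
    and \<mu>_pure: "\<And>\<xi> t. \<xi> \<in> carrier ?DD \<Longrightarrow> t \<in> carrier ?VV \<Longrightarrow> \<mu> (ptensor ?DD ?VV \<xi> t) = pairing2 V \<xi> t"
    unfolding \<mu>_def
    by (rule tensor_lift[OF _ _ _ pairing2_bilinear[OF V]]; simp)+
  have \<mu>L: "\<mu> (?L y) = 0" if "y \<in> carrier (tensor ?DD ?VV)" for y
  proof (rule tensor_ext[OF _ _ linear_compose[OF L \<mu>] linear_zero_map[of _ ground, simplified] _ that])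
    fix \<xi> t assume \<xi> [simp]: "\<xi> \<in> carrier ?DD" and t [simp]: "t \<in> carrier ?VV"
    note [simp] = linear_closed[OF T] linear_closed[OF R] linear_closed[OF N]
    have "\<mu> (?L (ptensor ?DD ?VV \<xi> t)) = pairing2 V (?N \<xi>) t + pairing2 V \<xi> (R t)"
      by (simp add: leibniz_pure[OF N R] linear_add[OF \<mu>] \<mu>_pure)
    also have "pairing2 V (?N \<xi>) t = - pairing2 V (transpose2 V R \<xi>) t"
      using linear_smult[OF pairing2_linear_left[OF V t], of "transpose2 V R \<xi>" "- 1"]
      by (simp add: vs_neg)
    finally show "\<mu> (?L (ptensor ?DD ?VV \<xi> t)) = 0" by (simp add: T_pairing)
  qed simp_all
  note E = ev_linear[OF V]
  note EE = tensor_map_linear[OF E E]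
  \<comment> \<open>The unit map \<open>k \<otimes> k \<rightarrow> k\<close> multiplies the two evaluations, turning them into the pairing.\<close>
  have lunit_ev: "lunit ground (tensor_map ?DV ?DV ground ground (ev V) (ev V) x) = \<mu> (middle_swap ?D V x)"
    if "x \<in> carrier (tensor ?DV ?DV)" for x
    by (rule tensor_ext_both[OF _ _ _ _ linear_compose[OF EE lunit_linear]
          linear_compose[OF middle_swap_linear \<mu>] _ that])
      (simp_all add: tensor_map_pure[OF E E] ev_pure lunit_pure middle_swap_pure \<mu>_pure pairing2_pure)
  let ?i = "inv_into (carrier (tensor ?DV ?DV)) (middle_swap ?D V)"
  have "tensor_map ?DV ?DV ground ground (ev V) (ev V) (?i (?L (middle_swap ?D V t)))
    = \<zero>\<^bsub>tensor ground ground\<^esub>" if t: "t \<in> carrier (tensor ?DV ?DV)" for t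
  proof (rule inj_onD[OF lunit_inj])
    have m: "middle_swap ?D V t \<in> carrier (tensor ?DD ?VV)"
      by (rule linear_closed[OF middle_swap_linear]) (simp_all add: t)
    have i: "?i (?L (middle_swap ?D V t)) \<in> carrier (tensor ?DV ?DV)"
      by (intro linear_closed[OF middle_swap_inv_linear] linear_closed[OF L] m) simp_all
    show "lunit ground (tensor_map ?DV ?DV ground ground (ev V) (ev V) (?i (?L (middle_swap ?D V t))))
        = lunit ground \<zero>\<^bsub>tensor ground ground\<^esub>"
      using linear_zero[OF lunit_linear[OF vs_ground]] linear_closed[OF L m]
      by (simp add: lunit_ev[OF i] middle_swap_inv \<mu>L[OF m])
    show "tensor_map ?DV ?DV ground ground (ev V) (ev V) (?i (?L (middle_swap ?D V t)))
        \<in> carrier (tensor ground ground)"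
      by (rule linear_closed[OF EE i])
  qed simp_all
  then show ?thesis
    using eqa_obj_tensor[OF eqa_obj_dagger[OF X, unfolded eqa_dagger.simps] X] eqa_obj_unit E
    unfolding eqa_dagger.simps eqa_tensor_eq eqa_unit_def eqa_arrow.simps by blast
qed

text \<open>The Leibniz operator of \<open>R\<close> and \<open>- R\<^sup>*\<close> kills the middle exchange of \<open>\<Omega> \<otimes> \<Omega>\<close> by
  \<open>transpose2_casimir\<close>. Since \<open>coev c = c \<Omega>\<close>, it therefore kills the image of \<open>coev \<otimes> coev\<close>, as an arrow
  from \<open>(k, 0)\<close> requires.\<close>

lemma coev_arrow:
  fixes V :: "('k::field, 'v) module"
  assumes X: "eqa_obj (V, R)"
  shows "eqa_arrow eqa_unit (eqa_tensor (V, R) (eqa_dagger (V, R))) (coev V)"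
proof -
  let ?D = "dual V"
  let ?DD = "tensor ?D ?D" and ?VV = "tensor V V" and ?VD = "tensor V ?D"
  note fd = eqa_obj_vspace(1)[OF X] and V [simp] = eqa_obj_vspace(2)[OF X] and R = eqa_obj_vspace(3)[OF X]
  obtain B where B: "is_basis V B" and coev: "coev V = (\<lambda>c. c \<odot>\<^bsub>?VD\<^esub> casimir V B)"
    using fd by (rule coev_eq)
  note [simp] = basis_mem[OF _ B] casimir_mem[OF _ B] basis2_mem[OF _ B]
  note T = transpose2_linear[OF V B R]
  let ?N = "\<lambda>\<xi>. \<ominus>\<^bsub>?DD\<^esub> transpose2 V R \<xi>"
  note [simp] = linear_closed[OF T] linear_closed[OF R]
  have N: "linear_on ?DD ?DD ?N" by (rule linear_neg_map[OF T])
  let ?L = "leibniz ?VV R ?DD ?N" and ?Y = "tensor ?VV ?DD" and ?P = "ptensor ?VV ?DD"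
  note L = leibniz_linear[OF R N]
  define h where "h x = ?L (middle_swap V ?D x)" for x
  have h: "linear_on (tensor ?VD ?VD) ?Y h"
    unfolding h_def by (intro linear_compose[OF _ L] middle_swap_linear) simp_all
  have "h (ptensor ?VD ?VD (casimir V B) (casimir V B)) = \<zero>\<^bsub>?Y\<^esub>"
  proof -
    let ?c = "\<lambda>b. ptensor V ?D b (dual_vector V B b)"
    have "ptensor ?VD ?VD (casimir V B) (casimir V B)
        = (\<Oplus>\<^bsub>tensor ?VD ?VD\<^esub> p\<in>B \<times> B. ptensor ?VD ?VD (?c (fst p)) (?c (snd p)))"
      unfolding casimir_def by (rule ptensor_finsum) simp_all
    then have "h (ptensor ?VD ?VD (casimir V B) (casimir V B))
        = h (\<Oplus>\<^bsub>tensor ?VD ?VD\<^esub> p\<in>B \<times> B. ptensor ?VD ?VD (?c (fst p)) (?c (snd p)))"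
      by (rule arg_cong)
    also have "\<dots> = (\<Oplus>\<^bsub>?Y\<^esub> p\<in>B \<times> B. h (ptensor ?VD ?VD (?c (fst p)) (?c (snd p))))"
      by (rule linear_finsum[OF h]) (auto intro!: ptensor_closed)
    also have "\<dots> = (\<Oplus>\<^bsub>?Y\<^esub> p\<in>B \<times> B. ?P (R (basis2 V p)) (dual_basis2 V B p)
        \<oplus>\<^bsub>?Y\<^esub> (- 1) \<odot>\<^bsub>?Y\<^esub> ?P (basis2 V p) (transpose2 V R (dual_basis2 V B p)))"
    proof (rule vs_finsum_cong)
      fix p assume p: "p \<in> B \<times> B"
      have "h (ptensor ?VD ?VD (?c (fst p)) (?c (snd p))) = ?L (?P (basis2 V p) (dual_basis2 V B p))"
        using p by (auto simp: h_def middle_swap_pure basis2_def dual_basis2_def)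
      then show "h (ptensor ?VD ?VD (?c (fst p)) (?c (snd p))) = ?P (R (basis2 V p)) (dual_basis2 V B p)
          \<oplus>\<^bsub>?Y\<^esub> (- 1) \<odot>\<^bsub>?Y\<^esub> ?P (basis2 V p) (transpose2 V R (dual_basis2 V B p))"
        using p by (simp add: leibniz_pure[OF R N] vs_neg ptensor_smult)
    qed simp_all
    also have "\<dots> = (\<Oplus>\<^bsub>?Y\<^esub> p\<in>B \<times> B. ?P (R (basis2 V p)) (dual_basis2 V B p))
        \<oplus>\<^bsub>?Y\<^esub> (\<Oplus>\<^bsub>?Y\<^esub> p\<in>B \<times> B. (- 1) \<odot>\<^bsub>?Y\<^esub> ?P (basis2 V p) (transpose2 V R (dual_basis2 V B p)))"
      by (rule vs_finsum_add) simp_all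
    also have "(\<Oplus>\<^bsub>?Y\<^esub> p\<in>B \<times> B. (- 1) \<odot>\<^bsub>?Y\<^esub> ?P (basis2 V p) (transpose2 V R (dual_basis2 V B p)))
        = (- 1) \<odot>\<^bsub>?Y\<^esub> (\<Oplus>\<^bsub>?Y\<^esub> p\<in>B \<times> B. ?P (basis2 V p) (transpose2 V R (dual_basis2 V B p)))"
      by (rule vs_finsum_smult[symmetric]) simp_all
    also have "(\<Oplus>\<^bsub>?Y\<^esub> p\<in>B \<times> B. ?P (basis2 V p) (transpose2 V R (dual_basis2 V B p)))
        = (\<Oplus>\<^bsub>?Y\<^esub> p\<in>B \<times> B. ?P (R (basis2 V p)) (dual_basis2 V B p))"
      by (rule transpose2_casimir[OF V B R, symmetric])
    finally show ?thesis by (simp flip: vs_neg)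
  qed
  note Chom = coev_linear[OF fd]
  note CC = tensor_map_linear[OF Chom Chom]
  have hC: "h (tensor_map ground ground ?VD ?VD (coev V) (coev V) t) = \<zero>\<^bsub>?Y\<^esub>"
    if "t \<in> carrier (tensor ground ground)" for t
  proof (rule tensor_ext[OF _ _ linear_compose[OF CC h] linear_zero_map _ that])
    fix c d :: 'k
    show "h (tensor_map ground ground ?VD ?VD (coev V) (coev V) (ptensor ground ground c d)) = \<zero>\<^bsub>?Y\<^esub>"
      using \<open>h (ptensor ?VD ?VD (casimir V B) (casimir V B)) = \<zero>\<^bsub>?Y\<^esub>\<close>
      by (simp add: tensor_map_pure[OF Chom Chom]) (simp add: coev ptensor_smult_both linear_smult[OF h])
  qed simp_all
  let ?i = "inv_into (carrier (tensor ?VD ?VD)) (middle_swap V ?D)"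
  have "tensor_map ground ground ?VD ?VD (coev V) (coev V) \<zero>\<^bsub>tensor ground ground\<^esub>
      = ?i (?L (middle_swap V ?D (tensor_map ground ground ?VD ?VD (coev V) (coev V) t)))"
    if "t \<in> carrier (tensor ground ground)" for t
    using hC[OF that] linear_zero[OF CC] linear_zero[OF middle_swap_inv_linear[OF V vs_dual[OF V]]]
    by (simp add: h_def)
  then show ?thesis
    using eqa_obj_tensor[OF X eqa_obj_dagger[OF X, unfolded eqa_dagger.simps]] eqa_obj_unit Chom
    unfolding eqa_dagger.simps eqa_tensor_eq eqa_unit_def eqa_arrow.simps by blast
qed

lemma eqa_dual:
  assumes X: "eqa_obj (V, R)"
  shows "eqa_is_dual (V, R) (eqa_dagger (V, R)) (ev V) (coev V)"
  using assms eqa_obj_dagger[OF X] ev_arrow[OF X] coev_arrow[OF X]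
    zigzag_left[OF eqa_obj_vspace(1)[OF X]] zigzag_right[OF eqa_obj_vspace(1)[OF X]]
  unfolding eqa_is_dual_def zigzag_def by simp

section \<open>Transposes of arrows\<close>

lemma transpose_map_linear:
  assumes l: "linear_on V W l"
  shows "linear_on (dual W) (dual V) (transpose_map V l)"
proof (rule linear_onI)
  show mem: "transpose_map V l g \<in> carrier (dual V)" if "g \<in> carrier (dual W)" for g
    using dual_restrict[OF linear_compose[OF l dual_linear[OF that]]] by (simp add: transpose_map_def)
qed (auto simp: transpose_map_def dual_simps linear_onD[OF l] fun_eq_iff)

lemma transpose_map_apply [simp]: "v \<in> carrier V \<Longrightarrow> transpose_map V l g v = g (l v)"
  by (simp add: transpose_map_def)

text \<open>On pure tensors both sides are \<open>f (l v) * g (l w)\<close>.\<close>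

lemma pairing2_transpose_map:
  assumes l: "linear_on V W l" and \<xi>: "\<xi> \<in> carrier (tensor (dual W) (dual W))"
    and t: "t \<in> carrier (tensor V V)"
  shows "pairing2 V (tensor_map (dual W) (dual W) (dual V) (dual V) (transpose_map V l) (transpose_map V l) \<xi>) t
    = pairing2 W \<xi> (tensor_map V V W W l l t)"
proof -
  note V [simp] = linear_dom[OF l] and W [simp] = linear_cod[OF l]
  note l' = transpose_map_linear[OF l]
  note ll = tensor_map_linear[OF l l] and ll' = tensor_map_linear[OF l' l']
  note [simp] = linear_closed[OF l] linear_closed[OF l'] linear_closed[OF ll] linear_closed[OF ll']
  show ?thesis
  proof (rule tensor_ext[OF _ _ linear_compose[OF ll' pairing2_linear_left] pairing2_linear_left _ \<xi>])
    fix f g assume f [simp]: "f \<in> carrier (dual W)" and g [simp]: "g \<in> carrier (dual W)"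
    have p: "ptensor (dual W) (dual W) f g \<in> carrier (tensor (dual W) (dual W))" by simp
    show "pairing2 V (tensor_map (dual W) (dual W) (dual V) (dual V) (transpose_map V l) (transpose_map V l)
          (ptensor (dual W) (dual W) f g)) t
        = pairing2 W (ptensor (dual W) (dual W) f g) (tensor_map V V W W l l t)"
      by (rule tensor_ext[OF _ _ pairing2_linear_right linear_compose[OF ll pairing2_linear_right] _ t])
        (simp_all add: tensor_map_pure[OF l l] tensor_map_pure[OF l' l'] pairing2_pure)
  qed (simp_all add: t)
qed

text \<open>Pairing \<open>(l\<^sup>* \<otimes> l\<^sup>*) (S\<^sup>* \<xi>)\<close> with \<open>t\<close> gives \<open>\<langle>\<xi>, S (l \<otimes> l) t\<rangle>\<close>, and pairing
  \<open>R\<^sup>* ((l\<^sup>* \<otimes> l\<^sup>*) \<xi>)\<close> with \<open>t\<close> gives \<open>\<langle>\<xi>, (l \<otimes> l) R t\<rangle>\<close>; these agree because \<open>l\<close> is an arrow, and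
  nondegeneracy of the pairing concludes.\<close>

lemma dagger_arrow:
  assumes l: "eqa_arrow (V, R) (W, S) l"
  shows "eqa_arrow (eqa_dagger (W, S)) (eqa_dagger (V, R)) (transpose_map V l)"
proof -
  let ?D = "dual V" and ?E = "dual W"
  have X: "eqa_obj (V, R)" and Y: "eqa_obj (W, S)" and lin: "linear_on V W l"
    and comm: "\<And>t. t \<in> carrier (tensor V V) \<Longrightarrow> tensor_map V V W W l l (R t) = S (tensor_map V V W W l l t)"
    using l by simp_all
  note V [simp] = eqa_obj_vspace(2)[OF X] and R = eqa_obj_vspace(3)[OF X]
    and W [simp] = eqa_obj_vspace(2)[OF Y] and S = eqa_obj_vspace(3)[OF Y]
  obtain B C where B: "is_basis V B" and C: "is_basis W C"
    using fd_vs_basis[OF eqa_obj_vspace(1)[OF X]] fd_vs_basis[OF eqa_obj_vspace(1)[OF Y]] by blast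
  note RT = transpose2_linear[OF V B R] and ST = transpose2_linear[OF W C S]
  note l' = transpose_map_linear[OF lin]
  let ?l = "tensor_map V V W W l l"
    and ?l' = "tensor_map ?E ?E ?D ?D (transpose_map V l) (transpose_map V l)"
  note ll = tensor_map_linear[OF lin lin] and ll' = tensor_map_linear[OF l' l']
  note [simp] = linear_closed[OF R] linear_closed[OF S] linear_closed[OF RT] linear_closed[OF ST]
    linear_closed[OF ll] linear_closed[OF ll']
  have "?l' (transpose2 W S \<xi>) = transpose2 V R (?l' \<xi>)" if \<xi> [simp]: "\<xi> \<in> carrier (tensor ?E ?E)" for \<xi>
  proof (rule pairing2_nondegenerate[OF V B])
    fix t assume t [simp]: "t \<in> carrier (tensor V V)"
    have "pairing2 V (?l' (transpose2 W S \<xi>)) t = pairing2 W \<xi> (S (?l t))"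
      by (simp add: pairing2_transpose_map[OF lin] transpose2_pairing[OF W C S])
    also have "\<dots> = pairing2 V (transpose2 V R (?l' \<xi>)) t"
      by (simp add: pairing2_transpose_map[OF lin] transpose2_pairing[OF V B R] flip: comm)
    finally show "pairing2 V (?l' (transpose2 W S \<xi>)) t = pairing2 V (transpose2 V R (?l' \<xi>)) t" .
  qed simp_all
  then have "?l' (\<ominus>\<^bsub>tensor ?E ?E\<^esub> transpose2 W S \<xi>) = \<ominus>\<^bsub>tensor ?D ?D\<^esub> transpose2 V R (?l' \<xi>)"
    if "\<xi> \<in> carrier (tensor ?E ?E)" for \<xi>
    using that by (simp add: vs_neg linear_smult[OF ll'])
  then show ?thesis
    using eqa_obj_dagger[OF X] eqa_obj_dagger[OF Y] l' by simp
qed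

theorem theorem4:
  fixes V :: "('k::real_or_complex, 'v) module"
    and W :: "('k, 'w) module"
    and U :: "('k, 'u) module"
  assumes "eqa_obj (V, R)" and "eqa_obj (W, S)" and "eqa_obj (U, T)"
  shows
    "eqa_is_dual (V, R) (eqa_dagger (V, R)) (ev V) (coev V) \<and>
     (\<forall>l. eqa_arrow (V, R) (W, S) l \<longrightarrow>
        eqa_arrow (eqa_dagger (W, S)) (eqa_dagger (V, R)) (transpose_map V l) \<and>
        (\<forall>g\<in>carrier (dual W).
           dual_arrow V (dual V) (coev V) W (dual W) (ev W) l g = transpose_map V l g)) \<and>
     (\<forall>f\<in>carrier (dual V). transpose_map V (\<lambda>v. v) f = f) \<and>
     (\<forall>l m. eqa_arrow (V, R) (W, S) l \<longrightarrow> eqa_arrow (W, S) (U, T) m \<longrightarrow>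
        (\<forall>h\<in>carrier (dual U).
           transpose_map V (m \<circ> l) h = transpose_map V l (transpose_map W m h)))"
proof (intro conjI allI impI ballI)
  show "eqa_is_dual (V, R) (eqa_dagger (V, R)) (ev V) (coev V)"
    using assms(1) by (rule eqa_dual)
next
  fix l assume "eqa_arrow (V, R) (W, S) l"
  then show "eqa_arrow (eqa_dagger (W, S)) (eqa_dagger (V, R)) (transpose_map V l)"
    by (rule dagger_arrow)
next
  fix l g assume "eqa_arrow (V, R) (W, S) l" and g: "g \<in> carrier (dual W)"
  then have "linear_on V W l" by simp
  then show "dual_arrow V (dual V) (coev V) W (dual W) (ev W) l g = transpose_map V l g"
    by (rule dual_arrow_transpose[OF eqa_obj_vspace(1)[OF assms(1)] eqa_obj_vspace(2)[OF assms(2)] _ g])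
next
  fix f assume "f \<in> carrier (dual V)"
  then show "transpose_map V (\<lambda>v. v) f = f" by (rule transpose_map_id)
next
  fix l m h assume "eqa_arrow (V, R) (W, S) l"
  then have "linear_on V W l" by simp
  then show "transpose_map V (m \<circ> l) h = transpose_map V l (transpose_map W m h)"
    by (auto simp: transpose_map_def linear_closed fun_eq_iff)
qed

end
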